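(* Let $\mathfrak{h}$ be the three-dimensional Heisenberg Lie algebra over $\mathbb{K}$ with basis $Q,P,E$, let $h,z\in\mathbb{K}$, $R\ge\frac12$, and let $$\pi\colon \mathrm{S}_R^\bullet(\mathfrak{h})\longrightarrow\mathcal{W}_R(\mathfrak{h})=\frac{\mathrm{S}_R^\bullet(\mathfrak{h})}{\langle E-h\mathbf{1}\rangle}$$ be the canonical projection. Then the map $\pi\circ\star_z\colon \mathrm{S}_R^\bullet(\mathfrak{h})\times \mathrm{S}_R^\bullet(\mathfrak{h})\to\mathcal{W}_R(\mathfrak{h})$ is continuous.
   Context: $\mathbb{K}$ is $\mathbb{R}$ or $\mathbb{C}$. $\mathfrak{h}$ has $[P,Q]=E$ and all other brackets of basis elements vanish. $p^n$ is the $n$-th projective tensor power of a (continuous) seminorm $p$ on $\mathfrak{h}$ ($p^0=|\cdot|$), $p_R=\sum_{n\ge0}n!^Rp^n$, and $\mathrm{S}_R^\bullet(\mathfrak{h})$ is the symmetric tensor algebra (symmetric tensors inside $\mathrm{T}^\bullet(\mathfrak{h})$) with the topology of all $p_R$. $\langle E-h\mathbf{1}\rangle$ is the ideal generated by $E-h\mathbf{1}$. The quotient $\mathcal{W}_R(\mathfrak{h})$ is identified with $\mathrm{S}^\bullet(\mathrm{span}\{Q,P\})$ via $\pi(Q^kP^\ell E^m)=h^mQ^kP^\ell$, with the topology given by the seminorms $p_R$ restricted to $\mathrm{S}^\bullet(\mathrm{span}\{Q,P\})$. The Gutt star product on $\mathrm{S}^\bullet(\mathfrak{h})$ is, for $f\in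 \mathrm{S}^k(\mathfrak{h})$, $g\in \mathrm{S}^\ell(\mathfrak{h})$, $f\star_zg=\sum_{n=0}^{k+\ell}z^n\pi_{k+\ell-n}\big(\mathfrak{q}^{-1}(\mathfrak{q}(f)\odot\mathfrak{q}(g))\big)$, where $\pi_n$ denotes the projection onto $\mathrm{S}^n(\mathfrak{h})$, $\odot$ the product of the universal enveloping algebra $\mathcal{U}(\mathfrak{h})$ and $\mathfrak{q}(\xi_1\cdots\xi_n)=\frac1{n!}\sum_\sigma\xi_{\sigma(1)}\odot\cdots\odot\xi_{\sigma(n)}$. *)

theory Defs
  imports "HOL-Analysis.Analysis" "HOL-Library.Poly_Mapping" "HOL-Combinatorics.Permutations"
begin

datatype hbasis = BQ | BP | BE

lemma UNIV_hbasis: "UNIV = {BQ, BP, BE}"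
  by (auto intro: hbasis.exhaust)

instance hbasis :: finite
  by standard (simp add: UNIV_hbasis)

text \<open>The Heisenberg algebra is \<open>'k ^ hbasis\<close> with \<open>axis b 1\<close> as its basis vectors.\<close>

definition heis_bracket :: "'k::comm_ring_1 ^ hbasis \<Rightarrow> 'k ^ hbasis \<Rightarrow> 'k ^ hbasis" where
  "heis_bracket x y = (\<chi> b. if b = BE then x $ BP * y $ BQ - x $ BQ * y $ BP else 0)"

lemma heis_bracket_basis:
  "heis_bracket (axis BP 1) (axis BQ 1) = axis BE 1"
  "heis_bracket (axis BP 1) (axis BE 1) = 0"
  "heis_bracket (axis BQ 1) (axis BE 1) = 0"
  "heis_bracket x x = 0"
  "heis_bracket x y = - heis_bracket y x"
  by (auto simp: heis_bracket_def vec_eq_iff axis_def algebra_simps)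

text \<open>Words with concatenation form the free monoid, written additively so that the monoid algebra
  \<open>hbasis list \<Rightarrow>\<^sub>0 'k\<close> carries the ring structure of \<open>Poly_Mapping\<close>. It is the free associative
  algebra on the basis, that is, the tensor algebra: the word \<open>[b1, \<dots>, bn]\<close> stands for
  \<open>b1 \<otimes> \<dots> \<otimes> bn\<close>, and the product is the tensor product.\<close>

instantiation list :: (type) monoid_add
begin
definition zero_list :: "'a list" where "zero_list = []"
definition plus_list :: "'a list \<Rightarrow> 'a list \<Rightarrow> 'a list" where "plus_list xs ys = xs @ ys"
instance by standard (simp_all add: zero_list_def plus_list_def)
end

type_synonym 'k tens = "hbasis list \<Rightarrow>\<^sub>0 'k"

abbreviation coef :: "'k::zero tens \<Rightarrow> hbasis list \<Rightarrow> 'k" where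
  "coef \<equiv> Poly_Mapping.lookup"

abbreviation tword :: "hbasis list \<Rightarrow> 'k::zero \<Rightarrow> 'k tens" where
  "tword \<equiv> Poly_Mapping.single"

definition tconst :: "'k::zero \<Rightarrow> 'k tens" where
  "tconst c = tword [] c"

definition tvec :: "'k::comm_monoid_add ^ hbasis \<Rightarrow> 'k tens" where
  "tvec v = (\<Sum>b\<in>UNIV. tword [b] (v $ b))"

lift_definition hpart :: "nat \<Rightarrow> 'k::zero tens \<Rightarrow> 'k tens"
  is "\<lambda>n f w. if length w = n then f w else 0"
  by (erule rev_finite_subset) auto

lemma coef_hpart: "coef (hpart n f) w = (if length w = n then coef f w else 0)"
  by transfer simp

definition symmetrize :: "'k::field_char_0 tens \<Rightarrow> 'k tens" where
  "symmetrize f = (\<Sum>w\<in>Poly_Mapping.keys f. \<Sum>\<sigma> | \<sigma> permutes {..<length w}.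
     tword (permute_list \<sigma> w) (coef f w / fact (length w)))"

lemma tword_mult: "tword u (a::'k::semiring_0) * tword v b = tword (u @ v) (a * b)"
  by (simp add: mult_single plus_list_def)

lemma tconst_mult_tword: "tconst (a::'k::semiring_0) * tword v b = tword v (a * b)"
  by (simp add: tword_mult tconst_def)

lemma coef_tconst_mult: "coef (tconst a * f) w = (a::'k::semiring_0) * coef f w"
proof -
  have "tconst a * f = Poly_Mapping.map ((*) a) f"
    by (simp add: tconst_def mult_map_scale_conv_mult zero_list_def)
  then show ?thesis by (simp add: map.rep_eq when_def)
qed

lemma tconst_1: "tconst (1::'k::semiring_1) = 1"
  by (simp add: tconst_def flip: single_one zero_list_def)

lemma tens_expand:
  fixes f :: "'k::comm_monoid_add tens"
  shows "f = (\<Sum>w\<in>Poly_Mapping.keys f. tword w (coef f w))"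
  by (rule poly_mapping_eqI)
    (auto simp: lookup_sum lookup_single when_def sum.delta in_keys_iff)

lemma tens_induct [case_names zero tword add]:
  fixes f :: "'k::comm_monoid_add tens"
  assumes "P 0" "\<And>w c. P (tword w c)" "\<And>f g. P f \<Longrightarrow> P g \<Longrightarrow> P (f + g)"
  shows "P f"
proof -
  have "P (\<Sum>w\<in>A. tword w (coef f w))" if "finite A" for A
    using that by induction (auto intro: assms)
  then show ?thesis by (subst tens_expand) simp
qed

lemma coef_symmetrize:
  "coef (symmetrize f) w =
    (\<Sum>\<sigma> | \<sigma> permutes {..<length w}. coef f (permute_list \<sigma> w)) / fact (length w)"
proof -
  let ?S = "{\<sigma>. \<sigma> permutes {..<length w}}"
  have fin: "finite ?S" by (simp add: finite_permutations)
  have eq: "permute_list \<sigma> v = w \<longleftrightarrow> v = permute_list (inv \<sigma>) w"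
    if "\<sigma> permutes {..<length w}" "length v = length w" for \<sigma> v
  proof
    assume "permute_list \<sigma> v = w"
    then have "permute_list (inv \<sigma>) w = permute_list (\<sigma> \<circ> inv \<sigma>) v"
      using that by (auto simp: permute_list_compose permutes_inv)
    then show "v = permute_list (inv \<sigma>) w"
      using that by (simp add: permutes_inv_o)
  next
    assume "v = permute_list (inv \<sigma>) w"
    then have "permute_list \<sigma> v = permute_list (inv \<sigma> \<circ> \<sigma>) w"
      using that by (auto simp: permute_list_compose permutes_inv)
    then show "permute_list \<sigma> v = w"
      using that by (simp add: permutes_inv_o)
  qed
  have "coef (symmetrize f) w = (\<Sum>v\<in>Poly_Mapping.keys f. \<Sum>\<sigma> | \<sigma> permutes {..<length v}.
          (coef f v / fact (length v) when permute_list \<sigma> v = w))"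
    by (simp add: symmetrize_def lookup_sum lookup_single)
  also have "\<dots> = (\<Sum>v\<in>Poly_Mapping.keys f. \<Sum>\<sigma>\<in>?S.
          (coef f v / fact (length w) when v = permute_list (inv \<sigma>) w))"
  proof (rule sum.cong[OF refl])
    fix v
    show "(\<Sum>\<sigma> | \<sigma> permutes {..<length v}.
          (coef f v / fact (length v) when permute_list \<sigma> v = w))
       = (\<Sum>\<sigma>\<in>?S. (coef f v / fact (length w) when v = permute_list (inv \<sigma>) w))"
    proof (cases "length v = length w")
      case True
      then show ?thesis by (intro sum.cong) (auto simp: eq)
    next
      case False
      then have "permute_list \<sigma> v \<noteq> w" "v \<noteq> permute_list (inv \<sigma>) w" for \<sigma>
        by (metis length_permute_list)+
      then show ?thesis by simp
    qed
  qed
  also have "\<dots> = (\<Sum>\<sigma>\<in>?S. \<Sum>v\<in>Poly_Mapping.keys f.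
          (coef f v / fact (length w) when v = permute_list (inv \<sigma>) w))"
    by (rule sum.swap)
  also have "\<dots> = (\<Sum>\<sigma>\<in>?S. coef f (permute_list (inv \<sigma>) w) / fact (length w))"
    by (intro sum.cong refl) (auto simp: when_def sum.delta in_keys_iff)
  also have "\<dots> = (\<Sum>\<sigma>\<in>?S. coef f (permute_list \<sigma> w) / fact (length w))"
    by (rule sum_permutations_inverse[symmetric])
  finally show ?thesis by (simp add: sum_divide_distrib)
qed

lemma symmetrize_add: "symmetrize (f + g) = symmetrize f + symmetrize g"
  by (rule poly_mapping_eqI)
    (simp add: coef_symmetrize lookup_add sum.distrib add_divide_distrib)

lemma symmetrize_0 [simp]: "symmetrize 0 = 0"
  by (simp add: symmetrize_def)

lemma symmetrize_sum: "symmetrize (sum f A) = (\<Sum>x\<in>A. symmetrize (f x))"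
  by (induction A rule: infinite_finite_induct) (simp_all add: symmetrize_add)

lemma symmetrize_tconst_mult: "symmetrize (tconst c * f) = tconst c * symmetrize f"
  by (rule poly_mapping_eqI)
    (simp add: coef_symmetrize coef_tconst_mult sum_distrib_left)

lemma symmetrize_tword:
  "symmetrize (tword w c) = (\<Sum>\<sigma> | \<sigma> permutes {..<length w}.
     tword (permute_list \<sigma> w) (c / fact (length w)))"
  by (cases "c = 0") (simp_all add: symmetrize_def)

lemma symmetrize_tword_mset:
  assumes "mset u = mset v"
  shows "symmetrize (tword u c) = symmetrize (tword v c)"
proof -
  obtain \<tau> where \<tau>: "\<tau> permutes {..<length v}" "permute_list \<tau> v = u"
    by (rule mset_eq_permutation[OF assms])
  have len: "length u = length v" using assms by (rule mset_eq_length)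
  have "symmetrize (tword u c) = (\<Sum>\<sigma> | \<sigma> permutes {..<length v}.
     tword (permute_list (\<tau> \<circ> \<sigma>) v) (c / fact (length v)))"
    unfolding symmetrize_tword len
    by (intro sum.cong refl) (use \<tau> in \<open>auto simp: permute_list_compose\<close>)
  also have "\<dots> = symmetrize (tword v c)"
    unfolding symmetrize_tword
    by (rule setum_permutations_compose_left[symmetric, OF \<tau>(1)])
  finally show ?thesis .
qed

definition symmetric_tensor :: "'k::zero tens \<Rightarrow> bool" where
  "symmetric_tensor f \<longleftrightarrow>
    (\<forall>w \<sigma>. \<sigma> permutes {..<length w} \<longrightarrow> coef f (permute_list \<sigma> w) = coef f w)"

lemma symmetrize_symmetric: "symmetric_tensor f \<Longrightarrow> symmetrize f = f"
  by (rule poly_mapping_eqI)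
    (simp add: coef_symmetrize symmetric_tensor_def card_permutations)

lemma symmetric_tensor_symmetrize: "symmetric_tensor (symmetrize f)"
  unfolding symmetric_tensor_def
proof (intro allI impI)
  fix w :: "hbasis list" and \<sigma> assume \<sigma>: "\<sigma> permutes {..<length w}"
  have "(\<Sum>\<tau> | \<tau> permutes {..<length w}. coef f (permute_list \<tau> (permute_list \<sigma> w)))
      = (\<Sum>\<tau> | \<tau> permutes {..<length w}. coef f (permute_list (\<sigma> \<circ> \<tau>) w))"
    by (intro sum.cong refl) (use \<sigma> in \<open>auto simp: permute_list_compose\<close>)
  also have "\<dots> = (\<Sum>\<tau> | \<tau> permutes {..<length w}. coef f (permute_list \<tau> w))"
    by (rule setum_permutations_compose_left[symmetric, OF \<sigma>])
  finally show "coef (symmetrize f) (permute_list \<sigma> w) = coef (symmetrize f) w"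
    by (simp add: coef_symmetrize)
qed

lemma symmetrize_idem [simp]: "symmetrize (symmetrize f) = symmetrize f"
  by (rule symmetrize_symmetric[OF symmetric_tensor_symmetrize])

lemma symmetrize_mult_tword:
  fixes a b :: "'k::field_char_0"
  shows "symmetrize (symmetrize (tword u a) * tword v b) = symmetrize (tword u a * tword v b)"
  "symmetrize (tword v b * symmetrize (tword u a)) = symmetrize (tword v b * tword u a)"
proof -
  have 1: "symmetrize (tword (permute_list \<sigma> u @ v) c) = symmetrize (tword (u @ v) c)"
    if "\<sigma> permutes {..<length u}" for \<sigma> c
    by (rule symmetrize_tword_mset) (use that in simp)
  have 2: "symmetrize (tword (v @ permute_list \<sigma> u) c) = symmetrize (tword (v @ u) c)"
    if "\<sigma> permutes {..<length u}" for \<sigma> c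
    by (rule symmetrize_tword_mset) (use that in simp)
  have c: "fact n * symmetrize (tword w (d / fact n)) = symmetrize (tword w d)"
    for n w and d :: 'k
  proof -
    have f: "(fact n :: 'k tens) = tconst (fact n)"
      by (metis of_nat_fact single_of_nat tconst_def zero_list_def)
    show ?thesis
      unfolding f symmetrize_tconst_mult[symmetric] tconst_mult_tword by simp
  qed
  show "symmetrize (symmetrize (tword u a) * tword v b) = symmetrize (tword u a * tword v b)"
    using c[of "length u" "u @ v" "a * b"]
    by (simp add: symmetrize_tword[of u] sum_distrib_right symmetrize_sum tword_mult 1
        card_permutations)
  show "symmetrize (tword v b * symmetrize (tword u a)) = symmetrize (tword v b * tword u a)"
    using c[of "length u" "v @ u" "b * a"]
    by (simp add: symmetrize_tword[of u] sum_distrib_left symmetrize_sum tword_mult 2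
        card_permutations)
qed

lemma symmetrize_mult_left: "symmetrize (symmetrize f * g) = symmetrize (f * g)"
proof (induction f rule: tens_induct)
  case (tword w c)
  show ?case
  proof (induction g rule: tens_induct)
    case (tword v d)
    show ?case by (rule symmetrize_mult_tword)
  qed (simp_all only: distrib_left symmetrize_add mult_zero_right)
qed (simp_all only: distrib_right symmetrize_add mult_zero_left symmetrize_0)

lemma symmetrize_mult_right: "symmetrize (f * symmetrize g) = symmetrize (f * g)"
proof (induction g rule: tens_induct)
  case (tword w c)
  show ?case
  proof (induction f rule: tens_induct)
    case (tword v d)
    show ?case by (rule symmetrize_mult_tword)
  qed (simp_all only: distrib_right symmetrize_add mult_zero_left)
qed (simp_all only: distrib_left symmetrize_add mult_zero_right symmetrize_0)

lemma symmetrize_mult_commute: "symmetrize (f * g) = symmetrize (g * f)"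
proof (induction f rule: tens_induct)
  case (tword w c)
  show ?case
  proof (induction g rule: tens_induct)
    case (tword v d)
    have "symmetrize (tword (w @ v) (c * d)) = symmetrize (tword (v @ w) (c * d))"
      by (rule symmetrize_tword_mset) simp
    then show ?case by (simp add: tword_mult mult.commute)
  qed (simp_all only: distrib_right distrib_left symmetrize_add mult_zero_left mult_zero_right)
qed (simp_all only: distrib_right distrib_left symmetrize_add mult_zero_left mult_zero_right)

typedef (overloaded) ('k::zero) symt = "{f :: 'k tens. symmetric_tensor f}"
  morphisms tens_of Abs_symt
  by (rule exI[of _ 0]) (simp add: symmetric_tensor_def)

setup_lifting type_definition_symt

lemma symmetric_tens_of: "symmetric_tensor (tens_of f)"
  using tens_of[of f] by simp

lemma symmetrize_tens_of [simp]: "symmetrize (tens_of f) = tens_of f"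
  by (rule symmetrize_symmetric[OF symmetric_tens_of])

instantiation symt :: (field_char_0) comm_ring_1
begin

lift_definition zero_symt :: "'a symt" is 0
  by (simp add: symmetric_tensor_def)
lift_definition one_symt :: "'a symt" is 1
  by (auto simp: symmetric_tensor_def lookup_one zero_list_def when_def)
    (metis length_0_conv length_permute_list)
lift_definition plus_symt :: "'a symt \<Rightarrow> 'a symt \<Rightarrow> 'a symt" is "(+)"
  by (simp add: symmetric_tensor_def lookup_add)
lift_definition minus_symt :: "'a symt \<Rightarrow> 'a symt \<Rightarrow> 'a symt" is "(-)"
  by (simp add: symmetric_tensor_def lookup_minus)
lift_definition uminus_symt :: "'a symt \<Rightarrow> 'a symt" is uminus
  by (simp add: symmetric_tensor_def)
lift_definition times_symt :: "'a symt \<Rightarrow> 'a symt \<Rightarrow> 'a symt" is "\<lambda>f g. symmetrize (f * g)"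
  by (rule symmetric_tensor_symmetrize)

instance
proof
  fix a b c :: "'a symt"
  show "a * b * c = a * (b * c)"
    by transfer (simp add: symmetrize_mult_left symmetrize_mult_right mult.assoc)
  show "a * b = b * a"
    by transfer (rule symmetrize_mult_commute)
  show "1 * a = a"
    by transfer (simp add: symmetrize_symmetric)
  show "(a + b) * c = a * c + b * c"
    by transfer (simp add: distrib_right symmetrize_add)
  show "(0::'a symt) \<noteq> 1"
    by transfer simp
qed (transfer; simp add: algebra_simps)+

end

lift_definition sconst :: "'k::zero \<Rightarrow> 'k symt" is tconst
  by (auto simp: symmetric_tensor_def tconst_def lookup_single when_def)
    (metis length_0_conv length_permute_list)

lift_definition svec :: "'k::comm_monoid_add ^ hbasis \<Rightarrow> 'k symt" is tvec
proof -
  fix v :: "'k ^ hbasis"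
  have "permute_list \<sigma> w = w" if "\<sigma> permutes {..<length w}" "length w = 1"
    for \<sigma> and w :: "hbasis list"
  proof -
    have "\<sigma> = id" using that by (simp add: lessThan_Suc permutes_sing)
    then show ?thesis by simp
  qed
  moreover have "coef (tvec v) w = 0" if "length w \<noteq> 1" for w
    using that by (auto simp: tvec_def lookup_sum lookup_single when_def intro!: sum.neutral)
  ultimately show "symmetric_tensor (tvec v)"
    unfolding symmetric_tensor_def by (metis length_permute_list)
qed

lift_definition shpart :: "nat \<Rightarrow> 'k::zero symt \<Rightarrow> 'k symt" is hpart
  by (simp add: symmetric_tensor_def coef_hpart)

definition degrees :: "'k::zero symt \<Rightarrow> nat set" where
  "degrees f = length ` Poly_Mapping.keys (tens_of f)"

inductive_set ideal_gen :: "'a::ring_1 set \<Rightarrow> 'a set" for X where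
  zero: "0 \<in> ideal_gen X"
| gen: "x \<in> X \<Longrightarrow> x \<in> ideal_gen X"
| add: "x \<in> ideal_gen X \<Longrightarrow> y \<in> ideal_gen X \<Longrightarrow> x + y \<in> ideal_gen X"
| left: "x \<in> ideal_gen X \<Longrightarrow> a * x \<in> ideal_gen X"
| right: "x \<in> ideal_gen X \<Longrightarrow> x * a \<in> ideal_gen X"

lemma ideal_gen_uminus: "x \<in> ideal_gen X \<Longrightarrow> - x \<in> ideal_gen X"
  using ideal_gen.left[of x X "-1"] by simp

lemma ideal_gen_diff: "x \<in> ideal_gen X \<Longrightarrow> y \<in> ideal_gen X \<Longrightarrow> x - y \<in> ideal_gen X"
  using ideal_gen.add[OF _ ideal_gen_uminus] by fastforce

lemma equiv_ideal_gen: "equivp (\<lambda>x y. x - y \<in> ideal_gen X)"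
proof (rule equivpI)
  show "reflp (\<lambda>x y. x - y \<in> ideal_gen X)"
    by (auto intro!: reflpI ideal_gen.zero)
  show "symp (\<lambda>x y. x - y \<in> ideal_gen X)"
    by (rule sympI) (metis ideal_gen_uminus minus_diff_eq)
  show "transp (\<lambda>x y. x - y \<in> ideal_gen X)"
    by (rule transpI) (metis ideal_gen.add diff_add_cancel add_diff_eq)
qed

definition uea_relations :: "'k::comm_ring_1 tens set" where
  "uea_relations = {tvec x * tvec y - tvec y * tvec x - tvec (heis_bracket x y) | x y. True}"

quotient_type (overloaded) 'k uea =
  "'k::comm_ring_1 tens" / "\<lambda>x y. x - y \<in> ideal_gen uea_relations"
  morphisms rep_uea uea_of
  by (rule equiv_ideal_gen)

instantiation uea :: (comm_ring_1) ring
begin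

lift_definition zero_uea :: "'a uea" is 0 .
lift_definition plus_uea :: "'a uea \<Rightarrow> 'a uea \<Rightarrow> 'a uea" is "(+)"
  by (drule (1) ideal_gen.add) (simp add: algebra_simps)
lift_definition uminus_uea :: "'a uea \<Rightarrow> 'a uea" is uminus
  by (drule ideal_gen_uminus) simp
lift_definition minus_uea :: "'a uea \<Rightarrow> 'a uea \<Rightarrow> 'a uea" is "(-)"
  by (drule (1) ideal_gen_diff) (simp add: algebra_simps)
lift_definition times_uea :: "'a uea \<Rightarrow> 'a uea \<Rightarrow> 'a uea" is "(*)"
proof -
  fix a b c d :: "'a tens"
  assume "a - b \<in> ideal_gen uea_relations" "c - d \<in> ideal_gen uea_relations"
  then have "(a - b) * c + b * (c - d) \<in> ideal_gen uea_relations"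
    by (intro ideal_gen.intros(3-)) auto
  then show "a * c - b * d \<in> ideal_gen uea_relations"
    by (simp add: algebra_simps)
qed

instance
  by standard (transfer; simp add: algebra_simps ideal_gen.zero)+

end

instantiation uea :: (comm_ring_1) monoid_mult
begin
lift_definition one_uea :: "'a uea" is 1 .
instance
  by standard (transfer; simp add: ideal_gen.zero algebra_simps)+
end

definition uconst :: "'k::comm_ring_1 \<Rightarrow> 'k uea" where
  "uconst c = uea_of (tconst c)"

definition uvec :: "'k::comm_ring_1 ^ hbasis \<Rightarrow> 'k uea" where
  "uvec v = uea_of (tvec v)"

text \<open>Linear extension of \<open>\<xi>\<^sub>1\<cdots>\<xi>\<^sub>n \<mapsto> (1/n!) \<Sum>\<sigma>. \<xi>\<^sub>\<sigma>\<^sub>(\<^sub>1\<^sub>) \<odot> \<cdots> \<odot> \<xi>\<^sub>\<sigma>\<^sub>(\<^sub>n\<^sub>)\<close>, using that a symmetric tensor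
  \<open>f = \<Sum>w. f\<^sub>w (w\<^sub>1 \<otimes> \<cdots> \<otimes> w\<^sub>n)\<close> equals its symmetrization \<open>\<Sum>w. f\<^sub>w (w\<^sub>1\<cdots>w\<^sub>n)\<close>. The formula for
  arbitrary vectors is \<open>quant_prod_list\<close> below.\<close>

definition quant :: "'k::field_char_0 symt \<Rightarrow> 'k uea" where
  "quant f = (\<Sum>w\<in>Poly_Mapping.keys (tens_of f).
     uconst (coef (tens_of f) w / fact (length w)) *
     (\<Sum>\<sigma> | \<sigma> permutes {..<length w}. \<Prod>b\<leftarrow>permute_list \<sigma> w. uvec (axis b 1)))"

lemma uea_of_simps:
  "uea_of 0 = 0" "uea_of 1 = 1" "uea_of (x + y) = uea_of x + uea_of y"
  "uea_of (x * y) = uea_of x * uea_of y"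
  by (transfer; simp add: ideal_gen.zero)+

lemma uea_of_sum: "uea_of (sum f A) = (\<Sum>x\<in>A. uea_of (f x))"
  by (induction A rule: infinite_finite_induct) (simp_all add: uea_of_simps)

lemma uea_of_prod_list: "uea_of (prod_list xs) = prod_list (map uea_of xs)"
  by (induction xs) (simp_all add: uea_of_simps)

lemma tvec_axis: "tvec (axis b (c::'k::comm_monoid_add)) = tword [b] c"
proof -
  have "tvec (axis b c) = (\<Sum>b'\<in>UNIV. if b' = b then tword [b] c else 0)"
    unfolding tvec_def by (intro sum.cong) (auto simp: axis_def)
  then show ?thesis by simp
qed

lemma prod_list_tvec_axis:
  "(\<Prod>b\<leftarrow>w. tvec (axis b 1)) = tword w (1::'k::comm_ring_1)"
  by (induction w) (simp_all add: tvec_axis tword_mult tconst_1[unfolded tconst_def])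

lemma quant_eq: "quant f = uea_of (tens_of f)"
proof -
  have "quant f = uea_of (symmetrize (tens_of f))"
    unfolding quant_def symmetrize_def uea_of_sum sum_distrib_left
    by (intro sum.cong refl)
      (simp add: uconst_def uvec_def tconst_mult_tword prod_list_tvec_axis flip: uea_of_simps
        uea_of_prod_list[of "map _ _", unfolded map_map o_def])
  then show ?thesis by simp
qed

lemma coef_tvec_Cons:
  "coef (tvec v * (f::'k::comm_ring_1 tens)) w =
    (case w of [] \<Rightarrow> 0 | b # w' \<Rightarrow> v $ b * coef f w')"
proof (induction f rule: tens_induct)
  case (tword u c)
  have "coef (tvec v * tword u c) w = (\<Sum>b\<in>UNIV. if b # u = w then v $ b * c else 0)"
    by (simp add: tvec_def sum_distrib_right tword_mult lookup_sum lookup_single when_def)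
  also have "\<dots> = (case w of [] \<Rightarrow> 0 | b # w' \<Rightarrow> v $ b * coef (tword u c) w')"
    by (auto split: list.split simp: lookup_single when_def)
  finally show ?case .
qed (auto split: list.split simp: distrib_left lookup_add)

lemma coef_prod_list_tvec:
  "coef (\<Prod>v\<leftarrow>vs. tvec v) w =
    (if length w = length vs then \<Prod>i<length vs. vs ! i $ (w ! i) else (0::'k::comm_ring_1))"
proof (induction vs arbitrary: w)
  case Nil
  show ?case by (simp add: lookup_one zero_list_def when_def)
next
  case (Cons v vs)
  show ?case
    by (cases w) (simp_all add: coef_tvec_Cons Cons.IH prod.lessThan_Suc_shift del: prod.lessThan_Suc)
qed

lemma symmetrize_prod_list_tvec:
  fixes vs :: "('k::field_char_0 ^ hbasis) list"
  shows "symmetrize (\<Prod>v\<leftarrow>vs. tvec v) = tconst (1 / fact (length vs)) *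
    (\<Sum>\<sigma> | \<sigma> permutes {..<length vs}. \<Prod>v\<leftarrow>permute_list \<sigma> vs. tvec v)"
proof (rule poly_mapping_eqI)
  fix w
  let ?n = "length vs"
  show "coef (symmetrize (\<Prod>v\<leftarrow>vs. tvec v)) w = coef (tconst (1 / fact ?n) *
    (\<Sum>\<sigma> | \<sigma> permutes {..<?n}. \<Prod>v\<leftarrow>permute_list \<sigma> vs. tvec v)) w"
  proof (cases "length w = ?n")
    case True
    have "(\<Sum>\<sigma> | \<sigma> permutes {..<?n}. \<Prod>i<?n. vs ! i $ (w ! \<sigma> i))
        = (\<Sum>\<sigma> | \<sigma> permutes {..<?n}. \<Prod>i<?n. vs ! i $ (w ! inv \<sigma> i))"
      by (rule sum_permutations_inverse)
    also have "\<dots> = (\<Sum>\<sigma> | \<sigma> permutes {..<?n}. \<Prod>i<?n. vs ! \<sigma> i $ (w ! i))"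
    proof (rule sum.cong[OF refl])
      fix \<sigma> assume "\<sigma> \<in> {\<sigma>. \<sigma> permutes {..<?n}}"
      then have \<sigma>: "\<sigma> permutes {..<?n}" by simp
      show "(\<Prod>i<?n. vs ! i $ (w ! inv \<sigma> i)) = (\<Prod>i<?n. vs ! \<sigma> i $ (w ! i))"
        using prod.permute[OF \<sigma>, of "\<lambda>i. vs ! i $ (w ! inv \<sigma> i)"] permutes_inverses[OF \<sigma>]
        by (simp add: o_def)
    qed
    finally show ?thesis
      using True
      by (simp add: coef_symmetrize coef_tconst_mult lookup_sum coef_prod_list_tvec)
        (simp add: permute_list_def)
  next
    case False
    then show ?thesis
      by (simp add: coef_symmetrize coef_tconst_mult lookup_sum coef_prod_list_tvec)
  qed
qed

lemma tens_of_prod_list: "tens_of (prod_list fs) = symmetrize (prod_list (map tens_of fs))"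
  by (induction fs)
    (use symmetrize_tens_of[of 1] in
      \<open>simp_all add: one_symt.rep_eq times_symt.rep_eq symmetrize_mult_right del: symmetrize_tens_of\<close>)

lemma quant_prod_list:
  "quant (\<Prod>v\<leftarrow>vs. svec v) = uconst (1 / fact (length vs)) *
    (\<Sum>\<sigma> | \<sigma> permutes {..<length vs}. \<Prod>v\<leftarrow>permute_list \<sigma> vs. uvec v)"
  by (simp add: quant_eq tens_of_prod_list svec.rep_eq o_def symmetrize_prod_list_tvec
      uea_of_simps uea_of_sum uea_of_prod_list uconst_def uvec_def)

text \<open>Bilinear extension from homogeneous \<open>f\<close> and \<open>g\<close>. By Poincare-Birkhoff-Witt, \<open>quant\<close> is
  bijective, so \<open>inv\<close> is its genuine inverse.\<close>

definition gutt_star :: "'k::field_char_0 \<Rightarrow> 'k symt \<Rightarrow> 'k symt \<Rightarrow> 'k symt" where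
  "gutt_star z f g = (\<Sum>k\<in>degrees f. \<Sum>l\<in>degrees g. \<Sum>n\<le>k + l.
     sconst (z ^ n) * shpart (k + l - n) (inv quant (quant (shpart k f) * quant (shpart l g))))"

text \<open>By the Gelfand-Mazur theorem the instances of \<open>real_normed_field\<close> are, up to isometric
  isomorphism, exactly the real and the complex numbers.\<close>

definition seminorm :: "('k::real_normed_field ^ hbasis \<Rightarrow> real) \<Rightarrow> bool" where
  "seminorm p \<longleftrightarrow> (\<forall>x y. p (x + y) \<le> p x + p y) \<and> (\<forall>c x. p (c *s x) = norm c * p x)"

text \<open>For \<open>n > 0\<close> scalars can be absorbed into the first factor, so finite sums of elementary
  tensors suffice to represent every tensor of degree \<open>n\<close>.\<close>

definition tensor_power_seminorm ::
    "('k::real_normed_field ^ hbasis \<Rightarrow> real) \<Rightarrow> nat \<Rightarrow> 'k tens \<Rightarrow> real" where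
  "tensor_power_seminorm p n f = (if n = 0 then norm (coef f []) else
     Inf {(\<Sum>vs\<leftarrow>vss. \<Prod>v\<leftarrow>vs. p v) | vss.
       (\<forall>vs\<in>set vss. length vs = n) \<and> f = (\<Sum>vs\<leftarrow>vss. \<Prod>v\<leftarrow>vs. tvec v)})"

definition seminorm_R ::
    "real \<Rightarrow> ('k::real_normed_field ^ hbasis \<Rightarrow> real) \<Rightarrow> 'k symt \<Rightarrow> real" where
  "seminorm_R R p f =
    (\<Sum>n\<in>degrees f. fact n powr R * tensor_power_seminorm p n (tens_of (shpart n f)))"

definition seminorm_topology :: "'a::ab_group_add set \<Rightarrow> ('a \<Rightarrow> real) set \<Rightarrow> 'a topology" where
  "seminorm_topology V \<P> =
    topology_generated_by {{y \<in> V. p (y - x) < \<epsilon>} | p x \<epsilon>. p \<in> \<P> \<and> x \<in> V \<and> 0 < \<epsilon>}"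

definition R_seminorms :: "real \<Rightarrow> ('k::real_normed_field symt \<Rightarrow> real) set" where
  "R_seminorms R = {seminorm_R R p | p. seminorm p \<and> continuous_on UNIV p}"

definition sym_topology :: "real \<Rightarrow> 'k::real_normed_field symt topology" where
  "sym_topology R = seminorm_topology UNIV (R_seminorms R)"

definition weyl_ideal :: "'k::field_char_0 \<Rightarrow> 'k symt set" where
  "weyl_ideal h = ideal_gen {svec (axis BE 1) - sconst h}"

definition weyl_rel :: "'k::field_char_0 \<Rightarrow> ('k symt \<times> 'k symt) set" where
  "weyl_rel h = {(f, g). f - g \<in> weyl_ideal h}"

definition weyl_proj :: "'k::field_char_0 \<Rightarrow> 'k symt \<Rightarrow> 'k symt set" where
  "weyl_proj h f = weyl_rel h `` {f}"

definition sym_QP :: "'k::zero symt set" where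
  "sym_QP = {f. \<forall>w\<in>Poly_Mapping.keys (tens_of f). BE \<notin> set w}"

text \<open>The identification of the quotient with \<open>sym_QP\<close>, the symmetric algebra over the span of
  \<open>Q\<close> and \<open>P\<close>: each coset has exactly one representative there, see \<open>weyl_repr_unique\<close> and
  \<open>weyl_repr_monomial\<close>.\<close>

definition weyl_repr :: "'k::field_char_0 symt set \<Rightarrow> 'k symt" where
  "weyl_repr C = (THE f. f \<in> C \<and> f \<in> sym_QP)"

definition weyl_topology :: "real \<Rightarrow> 'k::real_normed_field \<Rightarrow> 'k symt set topology" where
  "weyl_topology R h =
    pullback_topology (UNIV // weyl_rel h) weyl_repr (seminorm_topology sym_QP (R_seminorms R))"

definition teval :: "'k::field_char_0 \<Rightarrow> 'k tens \<Rightarrow> 'k tens" where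
  "teval h f = (\<Sum>w\<in>Poly_Mapping.keys f.
     tword (filter (\<lambda>b. b \<noteq> BE) w) (h ^ count_list w BE * coef f w))"

lemma teval_tword:
  "teval h (tword w c) = tword (filter (\<lambda>b. b \<noteq> BE) w) (h ^ count_list w BE * c)"
  by (cases "c = 0") (simp_all add: teval_def)

lemma teval_0 [simp]: "teval h 0 = 0"
  by (simp add: teval_def)

lemma teval_add: "teval h (f + g) = teval h f + teval h g"
  unfolding teval_def
  by (rule setsum_keys_plus_distrib) (simp_all add: single_add distrib_left)

lemma teval_sum: "teval h (sum f A) = (\<Sum>x\<in>A. teval h (f x))"
  by (induction A rule: infinite_finite_induct) (simp_all add: teval_add)

lemma teval_mult: "teval h (f * g) = teval h f * teval h g"
proof (induction f rule: tens_induct)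
  case (tword w c)
  show ?case
  proof (induction g rule: tens_induct)
    case (tword v d)
    show ?case by (simp add: tword_mult teval_tword power_add mult_ac)
  qed (simp_all add: distrib_left teval_add)
qed (simp_all add: distrib_right teval_add)

lemma symmetrize_teval: "symmetrize (teval h (symmetrize f)) = symmetrize (teval h f)"
proof (induction f rule: tens_induct)
  case (tword w c)
  let ?F = "filter (\<lambda>b. b \<noteq> BE)"
  let ?d = "h ^ count_list w BE * c"
  have 1: "symmetrize (teval h (tword (permute_list \<sigma> w) (c / fact (length w))))
      = tconst (1 / fact (length w)) * symmetrize (tword (?F w) ?d)"
    if "\<sigma> permutes {..<length w}" for \<sigma>
  proof -
    have m: "mset (permute_list \<sigma> w) = mset w" using that by simp
    then have "symmetrize (tword (?F (permute_list \<sigma> w)) (?d / fact (length w)))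
        = symmetrize (tword (?F w) (?d / fact (length w)))"
      by (intro symmetrize_tword_mset) simp
    moreover have "count_list (permute_list \<sigma> w) BE = count_list w BE"
      by (metis m count_mset)
    ultimately show ?thesis
      by (simp add: teval_tword tconst_mult_tword flip: symmetrize_tconst_mult)
  qed
  have "symmetrize (teval h (symmetrize (tword w c)))
      = (\<Sum>\<sigma> | \<sigma> permutes {..<length w}. tconst (1 / fact (length w)) * symmetrize (tword (?F w) ?d))"
    unfolding symmetrize_tword[of w] teval_sum symmetrize_sum
    by (intro sum.cong refl) (use 1 in simp)
  also have "\<dots> = tconst (of_nat (fact (length w))) *
      (tconst (1 / fact (length w)) * symmetrize (tword (?F w) ?d))"
    by (simp add: card_permutations tconst_def flip: single_of_nat zero_list_def)
  also have "\<dots> = symmetrize (tword (?F w) ?d)"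
    by (simp add: tconst_mult_tword flip: symmetrize_tconst_mult mult.assoc)
  finally show ?case by (simp add: teval_tword)
qed (simp_all add: symmetrize_add teval_add)

lift_definition seval :: "'k::field_char_0 \<Rightarrow> 'k symt \<Rightarrow> 'k symt" is "\<lambda>h f. symmetrize (teval h f)"
  by (rule symmetric_tensor_symmetrize)

lemma seval_0: "seval h 0 = 0"
  by transfer simp

lemma seval_add: "seval h (f + g) = seval h f + seval h g"
  by transfer (simp add: teval_add symmetrize_add)

lemma seval_mult: "seval h (f * g) = seval h f * seval h g"
  by transfer (simp add: symmetrize_teval teval_mult symmetrize_mult_left symmetrize_mult_right)

lemma seval_gen: "seval h (svec (axis BE 1) - sconst h) = 0"
proof transfer
  fix h :: "'k::field_char_0"
  have "tvec (axis BE 1) - tconst h = tword [BE] 1 + tword [] (- h)"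
    by (simp add: tvec_axis tconst_def single_uminus)
  then show "symmetrize (teval h (tvec (axis BE 1) - tconst h)) = 0"
    by (simp add: teval_add teval_tword flip: single_add)
qed

lemma seval_ideal: "f \<in> weyl_ideal h \<Longrightarrow> seval h f = 0"
  unfolding weyl_ideal_def
  by (induction f rule: ideal_gen.induct)
    (auto simp: seval_0 seval_add seval_mult seval_gen)

lemma seval_sym_QP: "f \<in> sym_QP \<Longrightarrow> seval h f = f"
  unfolding sym_QP_def
proof (clarify, transfer)
  fix f :: "'k::field_char_0 tens" and h
  assume f: "symmetric_tensor f" "\<forall>w\<in>Poly_Mapping.keys f. BE \<notin> set w"
  have "teval h f = (\<Sum>w\<in>Poly_Mapping.keys f. tword w (coef f w))"
    unfolding teval_def
  proof (rule sum.cong[OF refl])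
    fix w assume "w \<in> Poly_Mapping.keys f"
    then have "BE \<notin> set w" using f by auto
    then have "filter (\<lambda>b. b \<noteq> BE) w = w" "count_list w BE = 0"
      by (auto intro: filter_True)
    then show "tword (filter (\<lambda>b. b \<noteq> BE) w) (h ^ count_list w BE * coef f w) = tword w (coef f w)"
      by simp
  qed
  then have "teval h f = f" using tens_expand[of f] by simp
  then show "symmetrize (teval h f) = f"
    using f by (simp add: symmetrize_symmetric)
qed

lemma sym_QP_iff: "f \<in> sym_QP \<longleftrightarrow> (\<forall>w. BE \<in> set w \<longrightarrow> coef (tens_of f) w = 0)"
  by (auto simp: sym_QP_def in_keys_iff)

lemma sym_QP_diff: "f \<in> sym_QP \<Longrightarrow> g \<in> sym_QP \<Longrightarrow> f - g \<in> sym_QP"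
  by (simp add: sym_QP_iff minus_symt.rep_eq lookup_minus)

lemma seval_in_sym_QP: "seval h f \<in> sym_QP"
proof -
  have "coef (teval h f) w = 0" if "BE \<in> set w" for w and f :: "'a tens"
    using that
    by (auto simp: teval_def lookup_sum lookup_single when_def intro!: sum.neutral)
  then show ?thesis
    by (simp add: sym_QP_iff seval.rep_eq coef_symmetrize)
qed

lift_definition sword :: "hbasis list \<Rightarrow> 'k::field_char_0 \<Rightarrow> 'k symt"
  is "\<lambda>w c. symmetrize (tword w c)"
  by (rule symmetric_tensor_symmetrize)

lemma sword_append: "sword (u @ v) (a * b) = sword u a * sword v b"
  by transfer (simp add: symmetrize_mult_left symmetrize_mult_right tword_mult)

lemma sword_letter: "sword [b] 1 = svec (axis b 1)"
proof -
  have "tens_of (sword [b] 1) = symmetrize (tens_of (svec (axis b 1)) :: 'a tens)"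
    by (simp only: sword.rep_eq svec.rep_eq tvec_axis)
  then show ?thesis by (simp add: tens_of_inject)
qed

lemma sword_Nil: "sword [] c = sconst c"
proof -
  have "tens_of (sword [] c) = symmetrize (tens_of (sconst c) :: 'a tens)"
    by (simp only: sword.rep_eq sconst.rep_eq tconst_def)
  then show ?thesis by (simp add: tens_of_inject)
qed

lemma sconst_mult_sword: "sconst c * sword w d = sword w (c * d)"
  using sword_append[of "[]" w c d] by (simp add: sword_Nil)

lemma seval_sword: "seval h (sword w c) = sword (filter (\<lambda>b. b \<noteq> BE) w) (h ^ count_list w BE * c)"
  by transfer (simp add: symmetrize_teval teval_tword)

lemma symt_induct [case_names zero tword add]:
  fixes f :: "'k::field_char_0 symt"
  assumes "P 0" "\<And>w c. P (sword w c)" "\<And>f g. P f \<Longrightarrow> P g \<Longrightarrow> P (f + g)"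
  shows "P f"
proof -
  have "P (Abs_symt (symmetrize g))" for g :: "'k tens"
  proof (induction g rule: tens_induct)
    case zero
    then show ?case using assms(1) by (simp add: zero_symt_def)
  next
    case (tword w c)
    then show ?case using assms(2)[of w c] by (simp add: sword_def)
  next
    case (add f g)
    have "Abs_symt (symmetrize f) + Abs_symt (symmetrize g)
        = Abs_symt (symmetrize (f + g))"
      by (simp add: plus_symt_def Abs_symt_inverse symmetric_tensor_symmetrize symmetrize_add)
    then show ?case using assms(3)[OF add.IH] by simp
  qed
  from this[of "tens_of f"] show ?thesis by (simp add: tens_of_inverse)
qed

lemma weyl_ideal_seval: "f - seval h f \<in> weyl_ideal h"
proof (induction f rule: symt_induct)
  case zero
  then show ?case by (simp add: seval_0 weyl_ideal_def ideal_gen.zero)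
next
  case (tword w c)
  show ?case
  proof (induction w arbitrary: c)
    case Nil
    then show ?case by (simp add: seval_sword weyl_ideal_def ideal_gen.zero)
  next
    case (Cons b w)
    have eq: "sword (b # w) c = svec (axis b 1) * sword w c"
      using sword_append[of "[b]" w 1 c] by (simp add: sword_letter)
    show ?case
    proof (cases "b = BE")
      case True
      have "sword (b # w) c - seval h (sword (b # w) c)
        = (svec (axis BE 1) - sconst h) * sword w c + sconst h * (sword w c - seval h (sword w c))"
        unfolding eq using True
        by (simp add: seval_mult algebra_simps flip: sword_letter)
          (simp add: seval_sword sword_Nil sconst_mult_sword mult_ac flip: sword_append)
      also have "\<dots> \<in> weyl_ideal h"
        using Cons.IH[of c] unfolding weyl_ideal_def
        by (intro ideal_gen.add ideal_gen.left[of "sword w c - _"]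
            ideal_gen.right[of "_ - sconst h"]) (auto intro: ideal_gen.gen)
      finally show ?thesis .
    next
      case False
      then have "sword (b # w) c - seval h (sword (b # w) c)
        = svec (axis b 1) * (sword w c - seval h (sword w c))"
        unfolding eq
        by (simp add: seval_mult algebra_simps flip: sword_letter) (simp add: seval_sword)
      then show ?thesis
        using Cons.IH[of c] unfolding weyl_ideal_def by (simp add: ideal_gen.left)
    qed
  qed
next
  case (add f g)
  have "f + g - seval h (f + g) = (f - seval h f) + (g - seval h g)"
    by (simp add: seval_add)
  then show ?case using add.IH unfolding weyl_ideal_def by (simp only: ideal_gen.add)
qed

lemma mem_weyl_proj: "g \<in> weyl_proj h f \<longleftrightarrow> f - g \<in> weyl_ideal h"
  by (simp add: weyl_proj_def weyl_rel_def)

lemma equiv_weyl_rel: "equiv UNIV (weyl_rel h)"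
  using equiv_ideal_gen[of "{svec (axis BE 1) - sconst h}"]
  by (simp add: equivp_equiv weyl_rel_def weyl_ideal_def)

lemma weyl_repr_unique:
  assumes "C \<in> UNIV // weyl_rel h"
  shows "\<exists>!f. f \<in> C \<and> f \<in> sym_QP"
proof -
  obtain f where C: "C = weyl_proj h f"
    using assms unfolding weyl_proj_def by (auto elim: quotientE)
  show ?thesis
  proof (rule ex1I[of _ "seval h f"])
    show "seval h f \<in> C \<and> seval h f \<in> sym_QP"
      by (simp add: C mem_weyl_proj weyl_ideal_seval seval_in_sym_QP)
    fix g assume g: "g \<in> C \<and> g \<in> sym_QP"
    then have "f - g \<in> weyl_ideal h" by (simp add: C mem_weyl_proj)
    moreover have "f = (f - g) + g" by simp
    ultimately have "seval h f = seval h g"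
      using seval_add[of h "f - g" g] seval_ideal by fastforce
    then show "g = seval h f" using g seval_sym_QP[of g h] by simp
  qed
qed

lemma weyl_repr_proj: "weyl_repr (weyl_proj h f) = seval h f"
proof -
  have "weyl_proj h f \<in> UNIV // weyl_rel h"
    by (simp add: weyl_proj_def quotientI)
  from weyl_repr_unique[OF this] show ?thesis
    unfolding weyl_repr_def
    by (rule the1_equality) (simp add: mem_weyl_proj weyl_ideal_seval seval_in_sym_QP)
qed

lemma bij_betw_weyl_repr: "bij_betw weyl_repr (UNIV // weyl_rel h) sym_QP"
proof (rule bij_betw_byWitness[where f' = "weyl_proj h"])
  have C: "weyl_repr C \<in> C \<and> weyl_repr C \<in> sym_QP" if "C \<in> UNIV // weyl_rel h" for C
    unfolding weyl_repr_def by (rule theI'[OF weyl_repr_unique[OF that]])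
  show "\<forall>C\<in>UNIV // weyl_rel h. weyl_proj h (weyl_repr C) = C"
    using C equiv_weyl_rel unfolding weyl_proj_def
    by (metis Image_singleton_iff equiv_class_eq_iff quotientE)
  show "\<forall>f\<in>sym_QP. weyl_repr (weyl_proj h f) = f"
    by (simp add: weyl_repr_proj seval_sym_QP)
  show "weyl_repr ` (UNIV // weyl_rel h) \<subseteq> sym_QP"
    using C by auto
  show "weyl_proj h ` sym_QP \<subseteq> UNIV // weyl_rel h"
    by (auto simp: weyl_proj_def quotientI)
qed

lemma weyl_repr_monomial:
  "weyl_repr (weyl_proj h (svec (axis BQ 1) ^ k * svec (axis BP 1) ^ l * svec (axis BE 1) ^ m))
    = sconst (h ^ m) * (svec (axis BQ 1) ^ k * svec (axis BP 1) ^ l)"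
proof -
  have power: "seval h (f ^ n) = seval h f ^ n" if "seval h 1 = 1" for f n
    by (induction n) (simp_all add: seval_mult that)
  have one: "sconst 1 = (1 :: 'a symt)"
    by transfer (rule tconst_1)
  have 1: "seval h 1 = 1"
    using seval_sword[of h "[]" 1] by (simp add: sword_Nil one)
  have sc: "sconst h ^ m = sconst (h ^ m)" for m
  proof (induction m)
    case (Suc m)
    then show ?case using sconst_mult_sword[of h "[]" "h ^ m"] by (simp add: sword_Nil)
  qed (simp add: one)
  have "seval h (svec (axis BQ 1)) = svec (axis BQ 1)" "seval h (svec (axis BP 1)) = svec (axis BP 1)"
    "seval h (svec (axis BE 1)) = sconst h"
    using seval_sword[of h "[BQ]" 1] seval_sword[of h "[BP]" 1] seval_sword[of h "[BE]" 1]
    by (simp_all add: sword_letter sword_Nil)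
  then show ?thesis
    by (simp add: weyl_repr_proj seval_mult power[OF 1] sc mult_ac)
qed

end

theory Submission
  imports Defs
begin

text \<open>The enveloping algebra acts on polynomials by left multiplication in \<open>\<star>\<^sub>1\<close>:
  \<open>P\<close> as \<open>P + E/2 \<partial>\<^sub>Q\<close>, \<open>Q\<close> as \<open>Q - E/2 \<partial>\<^sub>P\<close>, \<open>E\<close> as \<open>E\<close>. Applied to the constant \<open>1\<close>, a symmetric
  tensor returns the polynomial it represents, so this action inverts \<open>quant\<close> and \<open>f \<star>\<^sub>1 g\<close> is the
  (not symmetric) tensor \<open>f \<otimes> g\<close> applied to \<open>1\<close>. For a single word of length \<open>N\<close>, each letter either
  raises the degree in \<open>Q, P\<close> or lowers it at the price of a factor of at most that degree.
  Weighting monomials of degree \<open>d\<close> by \<open>sqrt d!\<close>, both effects cost at most \<open>sqrt (N + 1)\<close>,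
  so the word is mapped to a polynomial with coefficients of size \<open>2\<^sup>N sqrt N! / sqrt d!\<close>;
  the powers of \<open>z\<close> and of \<open>E = h\<close> contribute only geometric factors. For \<open>R \<ge> 1/2\<close> this yields the seminorm
  estimate \<open>q(\<pi>(f \<star>\<^sub>z g)) \<le> p(f) p(g)\<close>.\<close>

subsection \<open>The action of the enveloping algebra on polynomials\<close>

definition lin :: "(hbasis list \<Rightarrow> 'k) \<Rightarrow> 'k::comm_ring_1 tens \<Rightarrow> 'k" where
  "lin F t = (\<Sum>w\<in>Poly_Mapping.keys t. coef t w * F w)"

lemma lin_tword [simp]: "lin F (tword w c) = c * F w"
  by (simp add: lin_def)

lemma lin_0 [simp]: "lin F 0 = 0"
  by (simp add: lin_def)

lemma lin_add: "lin F (s + t) = lin F s + lin F t"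
  unfolding lin_def by (rule setsum_keys_plus_distrib) (simp_all add: distrib_right)

lemma lin_diff: "lin F (s - t) = lin F s - lin F t"
  using lin_add[of F "s - t" t] by simp

lemma lin_sum: "lin F (sum f A) = (\<Sum>x\<in>A. lin F (f x))"
  by (induction A rule: infinite_finite_induct) (simp_all add: lin_add)

lemma lin_zero_fun [simp]: "lin (\<lambda>w. 0) t = 0"
  by (simp add: lin_def)

lemma lin_fun_add: "lin (\<lambda>w. F w + G w) t = lin F t + lin G t"
  by (simp add: lin_def sum.distrib distrib_left)

lemma lin_fun_diff: "lin (\<lambda>w. F w - G w) t = lin F t - lin G t"
  by (simp add: lin_def sum_subtractf right_diff_distrib)

lemma lin_fun_mult: "lin (\<lambda>w. x * F w) t = x * lin F t"
  by (simp add: lin_def sum_distrib_left mult.left_commute)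

lemma lin_fun_divide: "lin (\<lambda>w. F w / x) t = lin F t / (x :: 'k::field)"
  by (simp add: lin_def sum_divide_distrib)

lemma lin_mult: "lin F (s * t) = lin (\<lambda>u. lin (\<lambda>v. F (u @ v)) t) s"
proof (induction s rule: tens_induct)
  case (tword w c)
  show ?case
    by (induction t rule: tens_induct)
      (simp_all add: lin_add distrib_left tword_mult mult.assoc)
qed (simp_all add: lin_add distrib_right)

text \<open>A function \<open>\<phi>\<close> stands for the polynomial with coefficient \<open>\<phi> a b c\<close> at
  \<open>Q\<^sup>a P\<^sup>b E\<^sup>c\<close>.\<close>

fun act1 :: "hbasis \<Rightarrow> (nat \<Rightarrow> nat \<Rightarrow> nat \<Rightarrow> 'k) \<Rightarrow> nat \<Rightarrow> nat \<Rightarrow> nat \<Rightarrow> 'k::field_char_0" where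
  "act1 BQ \<phi> a b c = (if a = 0 then 0 else \<phi> (a - 1) b c)
     - (if c = 0 then 0 else of_nat (b + 1) / 2 * \<phi> a (b + 1) (c - 1))"
| "act1 BP \<phi> a b c = (if b = 0 then 0 else \<phi> a (b - 1) c)
     + (if c = 0 then 0 else of_nat (a + 1) / 2 * \<phi> (a + 1) b (c - 1))"
| "act1 BE \<phi> a b c = (if c = 0 then 0 else \<phi> a b (c - 1))"

definition actw :: "hbasis list \<Rightarrow> (nat \<Rightarrow> nat \<Rightarrow> nat \<Rightarrow> 'k) \<Rightarrow> nat \<Rightarrow> nat \<Rightarrow> nat \<Rightarrow> 'k::field_char_0" where
  "actw w = foldr act1 w"

lemma actw_simps [simp]: "actw [] \<phi> = \<phi>" "actw (b # w) \<phi> = act1 b (actw w \<phi>)"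
  by (simp_all add: actw_def)

definition tact :: "'k tens \<Rightarrow> (nat \<Rightarrow> nat \<Rightarrow> nat \<Rightarrow> 'k) \<Rightarrow> nat \<Rightarrow> nat \<Rightarrow> nat \<Rightarrow> 'k::field_char_0" where
  "tact t \<phi> a b c = lin (\<lambda>w. actw w \<phi> a b c) t"

text \<open>A letter acts by a linear operator, so it can be moved inside the finite linear
  combination formed by \<open>lin\<close>. In \<open>actw_tact\<close> this turns composition with
  a word into concatenation.\<close>

lemma act1_lin:
  "act1 x (\<lambda>a b c. lin (\<lambda>v. G v a b c) t) = (\<lambda>a b c. lin (\<lambda>v. act1 x (G v) a b c) t)"
  by (intro ext, cases x) (simp_all add: lin_fun_diff lin_fun_add lin_fun_divide lin_fun_mult)

lemma actw_tact: "actw u (tact t \<phi>) = (\<lambda>a b c. lin (\<lambda>v. actw (u @ v) \<phi> a b c) t)"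
  by (induction u) (simp_all add: act1_lin, simp add: tact_def fun_eq_iff)

text \<open>Concatenation of words is composition of operators, so \<open>tact\<close> is a
  representation of the tensor algebra.\<close>

lemma tact_mult: "tact (s * t) \<phi> = tact s (tact t \<phi>)"
  by (intro ext) (subst (1 2) tact_def, simp add: lin_mult actw_tact)

lemma tact_add: "tact (s + t) \<phi> a b c = tact s \<phi> a b c + tact t \<phi> a b c"
  by (simp add: tact_def lin_add)

lemma tact_diff: "tact (s - t) \<phi> a b c = tact s \<phi> a b c - tact t \<phi> a b c"
  by (simp add: tact_def lin_diff)

lemma act1_zero [simp]: "act1 x (\<lambda>a b c. 0) = (\<lambda>a b c. 0)"
  by (intro ext, cases x) simp_all

lemma actw_zero [simp]: "actw w (\<lambda>a b c. 0) = (\<lambda>a b c. 0)"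
  by (induction w) simp_all

lemma tact_zero [simp]: "tact t (\<lambda>a b c. 0) = (\<lambda>a b c. 0)"
  by (simp add: tact_def fun_eq_iff)

lemma tact_tvec: "tact (tvec v) \<phi> a b c = v $ BQ * act1 BQ \<phi> a b c + v $ BP * act1 BP \<phi> a b c
   + v $ BE * act1 BE \<phi> a b c"
  by (simp add: tact_def tvec_def lin_add UNIV_hbasis)

lemma act1_comb:
  "act1 i (\<lambda>a b c. x * f a b c + y * g a b c + z * h a b c) a b c
    = x * act1 i f a b c + y * act1 i g a b c + z * act1 i h a b c"
  by (cases i) (simp_all add: field_simps)

text \<open>\<open>E\<close> arises in two halves: the commutator of \<open>E/2 d/dQ\<close> with
  \<open>Q\<close>, and that of \<open>P\<close> with \<open>-E/2 d/dP\<close>. The multiplications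
  commute with each other, and so do the derivatives.\<close>

lemma act1_PQ: "act1 BP (act1 BQ \<phi>) a b c = act1 BQ (act1 BP \<phi>) a b c + act1 BE \<phi> a b c"
  by (cases a; cases b; cases c) (simp_all add: field_simps)

lemma act1_PE: "act1 BP (act1 BE \<phi>) a b c = act1 BE (act1 BP \<phi>) a b c"
  and act1_QE: "act1 BQ (act1 BE \<phi>) a b c = act1 BE (act1 BQ \<phi>) a b c"
  by (cases a; cases b; cases c; simp)+

text \<open>By bilinearity only the commutators of the letters matter. Hence the action descends
  from tensors to the enveloping algebra.\<close>

lemma tact_uea_relation:
  "tact (tvec x * tvec y - tvec y * tvec x - tvec (heis_bracket x y)) \<phi> = (\<lambda>a b c. 0)"
proof (intro ext)
  fix a b c
  have f: "tact (tvec v) \<psi> = (\<lambda>a b c. v $ BQ * act1 BQ \<psi> a b c + v $ BP * act1 BP \<psi> a b c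
   + v $ BE * act1 BE \<psi> a b c)" for v :: "'a ^ hbasis" and \<psi>
    by (intro ext) (rule tact_tvec)
  show "tact (tvec x * tvec y - tvec y * tvec x - tvec (heis_bracket x y)) \<phi> a b c = 0"
    unfolding tact_diff tact_mult f act1_comb act1_PQ act1_PE act1_QE
    by (simp add: heis_bracket_def algebra_simps del: act1.simps)
qed

text \<open>The vector \<open>\<phi>\<close> varies in the induction because a right multiple
  \<open>t * a\<close> acts as \<open>t\<close> on \<open>tact a \<phi>\<close>.\<close>

lemma tact_ideal:
  assumes "t \<in> ideal_gen uea_relations"
  shows "tact t \<phi> = (\<lambda>a b c. 0)"
  using assms
proof (induction arbitrary: \<phi>)
  case zero
  show ?case by (simp add: tact_def fun_eq_iff)
next
  case (gen t)
  then show ?case by (auto simp: uea_relations_def tact_uea_relation)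
next
  case (add s t)
  then show ?case by (simp add: tact_add fun_eq_iff)
qed (simp_all add: tact_mult)

lemma uea_of_eq_iff: "uea_of s = uea_of t \<longleftrightarrow> s - t \<in> ideal_gen uea_relations"
  by (rule uea.abs_eq_iff)

lemma tact_cong_uea:
  assumes "uea_of s = uea_of t"
  shows "tact s \<phi> = tact t \<phi>"
  using tact_ideal[of "s - t" \<phi>] assms tact_diff[of s t \<phi>]
  by (simp add: uea_of_eq_iff fun_eq_iff)

subsection \<open>Inverting the quantization map\<close>

definition cword :: "nat \<Rightarrow> nat \<Rightarrow> nat \<Rightarrow> hbasis list" where
  "cword a b c = replicate a BQ @ replicate b BP @ replicate c BE"

text \<open>The number of rearrangements of \<open>cword a b c\<close>. A symmetric tensor has the
  same coefficient at each of them, so the monomial they represent collects that coefficient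
  \<open>multinom a b c\<close> times.\<close>

definition multinom :: "nat \<Rightarrow> nat \<Rightarrow> nat \<Rightarrow> 'k::field_char_0" where
  "multinom a b c = fact (a + b + c) / (fact a * fact b * fact c)"

lemma symmetric_tensor_mset:
  assumes "symmetric_tensor f" "mset u = mset v"
  shows "coef f u = coef f v"
  using mset_eq_permutation[OF assms(2)] assms(1) unfolding symmetric_tensor_def by metis

lemma mset_cword: "mset w = mset (cword (count_list w BQ) (count_list w BP) (count_list w BE))"
proof (rule multiset_eqI)
  fix x
  show "count (mset w) x = count (mset (cword (count_list w BQ) (count_list w BP) (count_list w BE))) x"
    by (cases x) (simp_all add: cword_def count_mset)
qed

text \<open>The left quotient by a letter. It preserves symmetry and shortens words, which drives
  the induction in \<open>tact_symmetric_vac\<close>.\<close>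

lift_definition ldiv :: "hbasis \<Rightarrow> 'k::zero tens \<Rightarrow> 'k tens" is "\<lambda>x f w. f (x # w)"
  subgoal for x f
    using finite_vimageI[of "{w. f w \<noteq> 0}" "(#) x"] by (simp add: vimage_def)
  done

lemma coef_ldiv: "coef (ldiv x f) w = coef f (x # w)"
  by transfer simp

lemma symmetric_ldiv: "symmetric_tensor f \<Longrightarrow> symmetric_tensor (ldiv x f)"
  unfolding symmetric_tensor_def[of "ldiv x f"] coef_ldiv
  by (auto intro!: symmetric_tensor_mset)

lemma ldiv_decomp:
  fixes f :: "'k::field_char_0 tens"
  shows "f = tconst (coef f []) + (tword [BQ] 1 * ldiv BQ f + tword [BP] 1 * ldiv BP f
    + tword [BE] 1 * ldiv BE f)"
proof (rule poly_mapping_eqI)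
  fix w
  have 1: "coef (tword [x] 1 * g) w = (case w of [] \<Rightarrow> 0 | b # w' \<Rightarrow> if b = x then coef g w' else 0)"
    for x w and g :: "'k tens"
    using coef_tvec_Cons[of "axis x 1" g w] by (auto simp: tvec_axis[symmetric] axis_def split: list.split)
  show "coef f w = coef (tconst (coef f []) + (tword [BQ] 1 * ldiv BQ f + tword [BP] 1 * ldiv BP f
    + tword [BE] 1 * ldiv BE f)) w"
  proof (cases w)
    case (Cons b v)
    then show ?thesis
      by (cases b) (simp_all add: lookup_add 1 coef_ldiv tconst_def lookup_single)
  qed (simp add: lookup_add 1 tconst_def lookup_single)
qed

text \<open>The constant polynomial \<open>1\<close>.\<close>

definition vac :: "nat \<Rightarrow> nat \<Rightarrow> nat \<Rightarrow> 'k::zero_neq_one" where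
  "vac a b c = (if a = 0 \<and> b = 0 \<and> c = 0 then 1 else 0)"

lemma tact_tword_mult: "tact (tword [x] 1 * g) \<phi> = act1 x (tact g \<phi>)"
  unfolding tact_mult by (simp add: tact_def fun_eq_iff)

text \<open>Both sides equal \<open>(a+b+c+1)! / (a! b! c!)\<close>. This identity makes the
  derivative corrections of \<open>Q\<close> and \<open>P\<close> cancel on symmetric
  tensors.\<close>

lemma multinom_Suc:
  "of_nat (b + 1) * multinom a (b + 1) c = (of_nat (a + 1) * multinom (a + 1) b c :: 'k::field_char_0)"
  by (simp add: multinom_def fact_Suc divide_simps del: of_nat_Suc)

text \<open>Pascal's rule: the rearrangements are sorted by their first letter.\<close>

lemma multinom_rec:
  assumes "a + b + c \<noteq> 0"
  shows "(multinom a b c :: 'k::field_char_0) = (if a = 0 then 0 else multinom (a - 1) b c)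
    + (if b = 0 then 0 else multinom a (b - 1) c) + (if c = 0 then 0 else multinom a b (c - 1))"
proof -
  \<comment> \<open>Dropping one letter leaves \<open>M\<close> times the multiplicity of that
    letter, and this remains true for multiplicity zero.\<close>
  define M :: 'k where "M = fact (a + b + c - 1) / (fact a * fact b * fact c)"
  have 1: "(if a = 0 then 0 else multinom (a - 1) b c) = of_nat a * M"
    by (cases a) (simp_all add: M_def multinom_def fact_Suc divide_simps del: of_nat_Suc)
  have 2: "(if b = 0 then 0 else multinom a (b - 1) c) = of_nat b * M"
    by (cases b) (simp_all add: M_def multinom_def fact_Suc divide_simps del: of_nat_Suc)
  have 3: "(if c = 0 then 0 else multinom a b (c - 1)) = of_nat c * M"
    by (cases c) (simp_all add: M_def multinom_def fact_Suc divide_simps del: of_nat_Suc)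
  have "multinom a b c = of_nat (a + b + c) * M"
    using assms by (simp add: M_def multinom_def fact_reduce)
  then show ?thesis unfolding 1 2 3 by (simp add: algebra_simps)
qed

text \<open>In symmetric tensors the corrections of \<open>P\<close> and \<open>Q\<close> by derivatives cancel.\<close>

lemma tact_symmetric_vac:
  fixes f :: "'k::field_char_0 tens"
  assumes "symmetric_tensor f"
  shows "tact f vac a b c = coef f (cword a b c) * multinom a b c"
proof -
  \<comment> \<open>The induction is on a strict bound \<open>n\<close> for the word lengths: left
    quotients lower it by one, and \<open>n = 0\<close> forces \<open>f = 0\<close>.\<close>
  have *: "tact f vac a b c = coef f (cword a b c) * multinom a b c"
    if "symmetric_tensor f" "\<forall>w\<in>Poly_Mapping.keys f. length w < n" for f :: "'k tens" and n a b c
    using that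
  proof (induction n arbitrary: f a b c)
    case 0
    then have "f = 0" by (metis all_not_in_conv keys_eq_empty not_less_zero)
    then show ?case by (simp add: tact_def)
  next
    case (Suc n)
    have "tact (ldiv x f) vac = (\<lambda>a b c. coef f (x # cword a b c) * multinom a b c)" for x
    proof -
      have "symmetric_tensor (ldiv x f)" using Suc.prems by (simp add: symmetric_ldiv)
      moreover have "\<forall>w\<in>Poly_Mapping.keys (ldiv x f). length w < n"
      proof
        fix w assume "w \<in> Poly_Mapping.keys (ldiv x f)"
        then have "x # w \<in> Poly_Mapping.keys f" by (simp add: in_keys_iff coef_ldiv)
        then show "length w < n" using Suc.prems by fastforce
      qed
      ultimately show ?thesis by (intro ext) (simp add: Suc.IH coef_ldiv)
    qed
    then have eq: "tact f vac a b c = coef f [] * vac a b c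
        + act1 BQ (\<lambda>a b c. coef f (BQ # cword a b c) * multinom a b c) a b c
        + act1 BP (\<lambda>a b c. coef f (BP # cword a b c) * multinom a b c) a b c
        + act1 BE (\<lambda>a b c. coef f (BE # cword a b c) * multinom a b c) a b c"
      by (subst ldiv_decomp) (simp add: tact_add tact_tword_mult del: act1.simps,
        simp add: tact_def tconst_def)
    have m: "coef f u = coef f v" if "mset u = mset v" for u v
      using symmetric_tensor_mset[OF Suc.prems(1) that] .
    have q: "coef f (BQ # cword (a - 1) b c) = coef f (cword a b c)" if "a \<noteq> 0"
      using that by (intro m) (cases a, simp_all add: cword_def)
    have p: "coef f (BP # cword a (b - 1) c) = coef f (cword a b c)" if "b \<noteq> 0"
      using that by (intro m) (cases b, simp_all add: cword_def)
    have e: "coef f (BE # cword a b (c - 1)) = coef f (cword a b c)" if "c \<noteq> 0"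
      using that by (intro m) (cases c, simp_all add: cword_def)
    have pq: "coef f (BQ # cword a (b + 1) c') = coef f (BP # cword (a + 1) b c')" for c'
      by (intro m) (simp add: cword_def)
    show ?case
    proof (cases "a + b + c = 0")
      case True
      then show ?thesis unfolding eq by (simp add: vac_def cword_def multinom_def)
    next
      case False
      \<comment> \<open>The left side is the correction coming from \<open>Q\<close>, the right side
        the one coming from \<open>P\<close>. They enter the action with opposite signs and cancel,
        so only the multiplications by letters remain.\<close>
      have "of_nat (b + 1) / 2 * (coef f (BQ # cword a (b + 1) c') * multinom a (b + 1) c')
        = of_nat (a + 1) / 2 * (coef f (BP # cword (a + 1) b c') * multinom (a + 1) b c')" for c'
        unfolding pq using multinom_Suc[of b a c', where 'k = 'k]
          by (metis (no_types) mult.left_commute times_divide_eq_left)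
      then have "tact f vac a b c = (if a = 0 then 0 else coef f (BQ # cword (a - 1) b c) * multinom (a - 1) b c)
        + (if b = 0 then 0 else coef f (BP # cword a (b - 1) c) * multinom a (b - 1) c)
        + (if c = 0 then 0 else coef f (BE # cword a b (c - 1)) * multinom a b (c - 1))"
        unfolding eq act1.simps vac_def using False by (auto simp del: of_nat_add of_nat_Suc)
      also have "\<dots> = coef f (cword a b c) * ((if a = 0 then 0 else multinom (a - 1) b c)
        + (if b = 0 then 0 else multinom a (b - 1) c) + (if c = 0 then 0 else multinom a b (c - 1)))"
        using q p e by (cases "a = 0"; cases "b = 0"; cases "c = 0") (simp_all add: algebra_simps)
      finally show ?thesis by (simp only: multinom_rec[OF False])
    qed
  qed
  have "\<exists>n. \<forall>w\<in>Poly_Mapping.keys f. length w < n"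
    using finite_imageI[OF finite_keys, of length f]
    by (auto simp: finite_nat_set_iff_bounded)
  then obtain n where "\<forall>w\<in>Poly_Mapping.keys f. length w < n" by blast
  with assms show ?thesis by (rule *)
qed

text \<open>A multinomial coefficient is a positive integer, so dividing by it in
  \<open>gutt_coef\<close> does not increase norms.\<close>

lemma norm_multinom_ge_1: "norm (multinom a b c :: 'k::real_normed_field) \<ge> 1"
proof -
  have "fact a * fact b dvd (fact (a + b) :: nat)" by (rule fact_fact_dvd_fact)
  then have "fact a * fact b * fact c dvd (fact (a + b) * fact c :: nat)" by (rule mult_dvd_mono) simp
  also have "\<dots> dvd fact (a + b + c)" by (rule fact_fact_dvd_fact)
  finally have "fact a * fact b * fact c \<le> (fact (a + b + c) :: nat)"
    by (rule dvd_imp_le) simp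
  then have "real (fact a * fact b * fact c) \<le> real (fact (a + b + c))" by (rule of_nat_mono)
  moreover have "norm (multinom a b c :: 'k) = fact (a + b + c) / (fact a * fact b * fact c)"
    by (simp add: multinom_def norm_divide norm_mult norm_fact)
  ultimately show ?thesis by simp
qed

lemma multinom_nonzero: "multinom a b c \<noteq> (0 :: 'k::field_char_0)"
  by (simp add: multinom_def)

section \<open>Degree filtration of the enveloping algebra and surjectivity of quantization\<close>

definition lower :: "nat \<Rightarrow> 'k::comm_ring_1 uea set" where
  "lower n = {uea_of t | t. \<forall>w\<in>Poly_Mapping.keys t. length w < n}"

lemma lower_0: "0 \<in> lower n"
  unfolding lower_def by (rule CollectI, rule exI[of _ 0]) (simp add: uea_of_simps)

lemma lower_add: "x \<in> lower n \<Longrightarrow> y \<in> lower n \<Longrightarrow> x + y \<in> lower n"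
  unfolding lower_def using keys_add by (fastforce simp flip: uea_of_simps)

lemma lower_sum: "(\<And>i. i \<in> A \<Longrightarrow> f i \<in> lower n) \<Longrightarrow> sum f A \<in> lower n"
  by (induction A rule: infinite_finite_induct) (simp_all add: lower_0 lower_add)

lemma lower_tword: "length w < n \<Longrightarrow> uea_of (tword w c) \<in> lower n"
  unfolding lower_def by (rule CollectI, rule exI[of _ "tword w c"]) simp

lemma lower_letter_mult:
  assumes "x \<in> lower n"
  shows "uea_of (tword [b] 1) * x \<in> lower (Suc n)"
proof -
  obtain t where t: "x = uea_of t" "\<forall>w\<in>Poly_Mapping.keys t. length w < n"
    using assms by (auto simp: lower_def)
  have "uea_of (tword [b] 1) * x = (\<Sum>w\<in>Poly_Mapping.keys t. uea_of (tword (b # w) (coef t w)))"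
    by (subst t(1), subst tens_expand)
      (simp add: sum_distrib_left tword_mult uea_of_sum flip: uea_of_simps)
  also have "\<dots> \<in> lower (Suc n)"
    using t(2) by (intro lower_sum lower_tword) simp
  finally show ?thesis .
qed

lemma uea_commutator:
  "uea_of (tvec x) * uea_of (tvec y) = uea_of (tvec y) * uea_of (tvec x)
    + uea_of (tvec (heis_bracket x y))"
proof -
  have "tvec x * tvec y - tvec y * tvec x - tvec (heis_bracket x y) \<in> ideal_gen uea_relations"
    by (rule ideal_gen.gen) (auto simp: uea_relations_def)
  then have "uea_of (tvec x * tvec y) = uea_of (tvec y * tvec x + tvec (heis_bracket x y))"
    by (simp add: uea_of_eq_iff diff_diff_eq)
  then show ?thesis by (simp add: uea_of_simps)
qed

text \<open>The difference is the bracket of the two letters times \<open>w\<close>. The bracket has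
  degree one, so only words of length \<open>length w + 1\<close> occur.\<close>

lemma swap_letters_lower:
  "uea_of (tword (x # y # w) c) - uea_of (tword (y # x # w) c) \<in> lower (length w + 2)"
proof -
  let ?B = "tvec (heis_bracket (axis x 1) (axis y 1))"
  have "uea_of (tword (x # y # w) c) - uea_of (tword (y # x # w) c) = uea_of (?B * tword w c)"
    using arg_cong[OF uea_commutator[of "axis x 1" "axis y 1"], of "\<lambda>u. u * uea_of (tword w c)"]
    by (simp add: tvec_axis tword_mult distrib_right flip: uea_of_simps(4))
  also have "?B * tword w c = (\<Sum>b\<in>UNIV. tword (b # w) (heis_bracket (axis x 1) (axis y 1) $ b * c))"
    by (simp add: tvec_def sum_distrib_right tword_mult)
  also have "uea_of \<dots> \<in> lower (length w + 2)"
    unfolding uea_of_sum by (intro lower_sum lower_tword) simp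
  finally show ?thesis .
qed

lemma letter_mult_word: "uea_of (tword [x] 1) * uea_of (tword w c) = uea_of (tword (x # w) c)"
  by (simp add: tword_mult flip: uea_of_simps)

lemma move_letter_lower:
  "uea_of (tword (x # u @ v) c) - uea_of (tword (u @ x # v) c) \<in> lower (length u + length v + 1)"
proof (induction u)
  case Nil
  then show ?case by (simp add: lower_0)
next
  case (Cons y u)
  have "uea_of (tword (x # y # u @ v) c) - uea_of (tword (y # u @ x # v) c)
    = (uea_of (tword (x # y # u @ v) c) - uea_of (tword (y # x # u @ v) c))
     + uea_of (tword [y] 1) * (uea_of (tword (x # u @ v) c) - uea_of (tword (u @ x # v) c))"
    by (simp add: right_diff_distrib letter_mult_word)
  also have "\<dots> \<in> lower (length (y # u) + length v + 1)"
    using swap_letters_lower[of x y "u @ v" c] lower_letter_mult[OF Cons.IH, of y]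
    by (intro lower_add) simp_all
  finally show ?case by simp
qed

text \<open>The first letter of \<open>u\<close> is located in \<open>v\<close> and moved to the
  front there, at the cost of lower terms. The rest follows by induction, multiplied by that
  letter.\<close>

lemma mset_eq_lower:
  "mset u = mset v \<Longrightarrow> uea_of (tword u c) - uea_of (tword v c) \<in> lower (length u)"
proof (induction u arbitrary: v)
  case Nil
  then show ?case by (simp add: lower_0)
next
  case (Cons x u)
  then obtain v1 v2 where v: "v = v1 @ x # v2"
    by (metis list.set_intros(1) set_mset_mset split_list)
  then have m: "mset u = mset (v1 @ v2)" using Cons.prems by simp
  then have len: "length u = length v1 + length v2" by (metis length_append mset_eq_length)
  have "uea_of (tword (x # u) c) - uea_of (tword v c)
    = uea_of (tword [x] 1) * (uea_of (tword u c) - uea_of (tword (v1 @ v2) c))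
     + (uea_of (tword (x # v1 @ v2) c) - uea_of (tword (v1 @ x # v2) c))"
    by (simp add: right_diff_distrib letter_mult_word v)
  also have "\<dots> \<in> lower (length (x # u))"
    using lower_letter_mult[OF Cons.IH[OF m], of x] move_letter_lower[of x v1 v2 c]
    by (intro lower_add) (simp_all add: len)
  finally show ?case .
qed

text \<open>The symmetrization is an average over rearrangements of \<open>w\<close>, each of which
  agrees with \<open>w\<close> modulo lower terms.\<close>

lemma symmetrize_lower: "uea_of (tword w c) - uea_of (symmetrize (tword w c)) \<in> lower (length w)"
proof -
  let ?S = "{\<sigma>. \<sigma> permutes {..<length w}}" and ?d = "c / fact (length w)"
  have "tword w c = of_nat (card ?S) * tword w ?d"
    by (simp add: card_permutations tconst_mult_tword[unfolded tconst_def] flip: single_of_nat zero_list_def)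
      (simp add: zero_list_def tword_mult)
  then have "uea_of (tword w c) = (\<Sum>\<sigma>\<in>?S. uea_of (tword w ?d))"
    unfolding uea_of_sum[symmetric] by simp
  moreover have "uea_of (symmetrize (tword w c)) = (\<Sum>\<sigma>\<in>?S. uea_of (tword (permute_list \<sigma> w) ?d))"
    by (simp add: symmetrize_tword uea_of_sum)
  ultimately have "uea_of (tword w c) - uea_of (symmetrize (tword w c))
    = (\<Sum>\<sigma>\<in>?S. uea_of (tword w ?d) - uea_of (tword (permute_list \<sigma> w) ?d))"
    by (simp only: sum_subtractf)
  also have "\<dots> \<in> lower (length w)"
    by (intro lower_sum mset_eq_lower) simp
  finally show ?thesis .
qed

lemma quant_add: "quant (f + g) = quant f + quant g"
  by (simp add: quant_eq plus_symt.rep_eq uea_of_simps)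

lemma quant_0: "quant 0 = 0"
  by (simp add: quant_eq zero_symt.rep_eq uea_of_simps)

lemma quant_sword: "quant (sword w c) = uea_of (symmetrize (tword w c))"
  by (simp add: quant_eq sword.rep_eq)

text \<open>The surjectivity half of Poincare-Birkhoff-Witt. A word is the quantization of its
  symmetrization plus lower terms, which are in the range by induction. As the bound in
  \<open>lower\<close> is strict, the induction starts from \<open>lower 0\<close>, which is
  zero.\<close>

lemma lower_subset_range_quant: "lower n \<subseteq> range (quant :: 'k::field_char_0 symt \<Rightarrow> _)"
proof (induction n)
  case 0
  have "t = 0" if "\<forall>w\<in>Poly_Mapping.keys t. length w < 0" for t :: "'k tens"
    using that by (metis all_not_in_conv keys_eq_empty not_less_zero)
  then have "lower 0 \<subseteq> {0 :: 'k uea}" by (auto simp: lower_def uea_of_simps)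
  moreover have "0 \<in> range (quant :: 'k symt \<Rightarrow> _)" by (metis quant_0 rangeI)
  ultimately show ?case by blast
next
  case (Suc n)
  have word: "uea_of (tword w c) \<in> range quant" if "length w < Suc n" for w and c :: 'k
  proof -
    have "lower (length w) \<subseteq> lower n" using that by (fastforce simp: lower_def)
    then obtain g where "uea_of (tword w c) - uea_of (symmetrize (tword w c)) = quant g"
      using symmetrize_lower[of w c] Suc.IH by blast
    then have "uea_of (tword w c) = quant (sword w c + g)"
      by (simp add: quant_add quant_sword algebra_simps)
    then show ?thesis by blast
  qed
  have sum: "sum f A \<in> range quant" if "\<And>i. i \<in> A \<Longrightarrow> f i \<in> range (quant :: 'k symt \<Rightarrow> _)" for f and A :: "hbasis list set"
    using that
  proof (induction A rule: infinite_finite_induct)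
    case (insert x F)
    then obtain g h where "f x = quant g" "sum f F = quant h" by (metis image_iff insertCI)
    with insert show ?case by (auto simp flip: quant_add)
  qed (use quant_0[where 'a = 'k] in \<open>auto intro: range_eqI[of _ _ 0]\<close>)
  show ?case
  proof
    fix x :: "'k uea" assume "x \<in> lower (Suc n)"
    then obtain t where t: "x = uea_of t" "\<forall>w\<in>Poly_Mapping.keys t. length w < Suc n"
      by (auto simp: lower_def)
    have "x = (\<Sum>w\<in>Poly_Mapping.keys t. uea_of (tword w (coef t w)))"
      using t(1) tens_expand[of t] by (simp flip: uea_of_sum)
    then show "x \<in> range quant" using t(2) word sum by simp
  qed
qed

text \<open>A tensor has finitely many words, so its class lies in some \<open>lower n\<close>.
  Surjectivity gives \<open>quant (inv quant u) = u\<close>.\<close>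

lemma surj_quant: "surj (quant :: 'k::field_char_0 symt \<Rightarrow> _)"
proof -
  have "uea_of t \<in> range quant" for t :: "'k tens"
  proof -
    obtain n where "\<forall>w\<in>Poly_Mapping.keys t. length w < n"
      using finite_imageI[OF finite_keys, of length t]
      by (auto simp: finite_nat_set_iff_bounded)
    then have "uea_of t \<in> lower n" by (auto simp: lower_def)
    then show ?thesis using lower_subset_range_quant by blast
  qed
  moreover have "\<exists>t. x = uea_of t" for x :: "'k uea"
    by (rule uea.abs_induct[of "\<lambda>x. \<exists>t. x = uea_of t"]) blast
  ultimately show ?thesis by (metis UNIV_I subsetI subset_antisym subset_UNIV)
qed

text \<open>\<open>t\<close> and the symmetric tensor \<open>inv quant (uea_of t)\<close> have the
  same class, hence the same action on \<open>vac\<close>. For the symmetric one that action reveals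
  the coefficients.\<close>

lemma coef_inv_quant:
  fixes t :: "'k::field_char_0 tens"
  shows "coef (tens_of (inv quant (uea_of t))) w
    = tact t vac (count_list w BQ) (count_list w BP) (count_list w BE)
      / multinom (count_list w BQ) (count_list w BP) (count_list w BE)"
proof -
  define y where "y = inv quant (uea_of t)"
  have "uea_of (tens_of y) = uea_of t"
    unfolding y_def quant_eq[symmetric] by (rule surj_f_inv_f[OF surj_quant])
  then have "tact t vac = tact (tens_of y) vac" by (intro tact_cong_uea) simp
  moreover have "coef (tens_of y) w = coef (tens_of y)
      (cword (count_list w BQ) (count_list w BP) (count_list w BE))"
    using symmetric_tensor_mset[OF symmetric_tens_of mset_cword] .
  ultimately show ?thesis
    by (simp add: tact_symmetric_vac[OF symmetric_tens_of] multinom_nonzero flip: y_def)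
qed

subsection \<open>The star product on words\<close>

lemma finite_degrees: "finite (degrees f)"
  by (simp add: degrees_def)

lemma keys_hpart: "Poly_Mapping.keys (hpart n f) = {w \<in> Poly_Mapping.keys f. length w = n}"
  by (auto simp: in_keys_iff coef_hpart split: if_splits)

lemma sum_hpart: "(\<Sum>n\<in>degrees f. hpart n (tens_of f)) = tens_of f"
proof (rule poly_mapping_eqI)
  fix w
  have "coef (\<Sum>n\<in>degrees f. hpart n (tens_of f)) w
    = (if length w \<in> degrees f then coef (tens_of f) w else 0)"
    by (simp add: lookup_sum coef_hpart finite_degrees)
  also have "\<dots> = coef (tens_of f) w"
    by (auto simp: degrees_def in_keys_iff)
  finally show "coef (\<Sum>n\<in>degrees f. hpart n (tens_of f)) w = coef (tens_of f) w" .
qed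

lemma lin_hpart_cong:
  "(\<And>w. length w = n \<Longrightarrow> F w = G w) \<Longrightarrow> lin F (hpart n t) = lin G (hpart n t)"
  by (auto simp: lin_def keys_hpart intro!: sum.cong)

lemma coef_symt_sum: "coef (tens_of (sum f A)) w = (\<Sum>x\<in>A. coef (tens_of (f x)) w)"
  by (induction A rule: infinite_finite_induct)
    (simp_all add: zero_symt.rep_eq plus_symt.rep_eq lookup_add)

lemma coef_sconst_mult: "coef (tens_of (sconst c * f)) w = c * coef (tens_of f) w"
  by (simp add: times_symt.rep_eq sconst.rep_eq symmetrize_tconst_mult coef_tconst_mult)

text \<open>What a word \<open>s\<close> of the tensor product of \<open>f\<close> and
  \<open>g\<close> contributes to the coefficient of the star product at \<open>w\<close>. The power
  of \<open>z\<close> is the loss of degree, and the case distinction keeps the subtraction on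
  \<open>nat\<close> from truncating.\<close>

definition gutt_coef :: "'k \<Rightarrow> hbasis list \<Rightarrow> hbasis list \<Rightarrow> 'k::field_char_0" where
  "gutt_coef z w s = (if length w \<le> length s then z ^ (length s - length w) *
    (actw s vac (count_list w BQ) (count_list w BP) (count_list w BE)
      / multinom (count_list w BQ) (count_list w BP) (count_list w BE)) else 0)"

text \<open>For given degrees \<open>k\<close> and \<open>l\<close> the power of \<open>z\<close> is
  fixed by the length of \<open>w\<close>, so the sums over degrees reassemble the full tensor
  \<open>tens_of f * tens_of g\<close>.\<close>

lemma coef_gutt_star:
  "coef (tens_of (gutt_star z f g)) w = lin (gutt_coef z w) (tens_of f * tens_of g)"
proof -
  let ?A = "\<lambda>s. actw s vac (count_list w BQ) (count_list w BP) (count_list w BE)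
      / multinom (count_list w BQ) (count_list w BP) (count_list w BE)"
  let ?H = "\<lambda>k l. hpart k (tens_of f) * hpart l (tens_of g)"
  have "(\<Sum>n\<le>k + l. coef (tens_of (sconst (z ^ n) *
      shpart (k + l - n) (inv quant (quant (shpart k f) * quant (shpart l g))))) w)
    = lin (gutt_coef z w) (?H k l)" for k l
  proof -
    have "coef (tens_of (inv quant (quant (shpart k f) * quant (shpart l g)))) w = lin ?A (?H k l)"
      by (simp add: quant_eq shpart.rep_eq coef_inv_quant tact_def lin_fun_divide flip: uea_of_simps)
    then have "(\<Sum>n\<le>k + l. coef (tens_of (sconst (z ^ n) *
        shpart (k + l - n) (inv quant (quant (shpart k f) * quant (shpart l g))))) w)
      = (\<Sum>n\<le>k + l. if length w = k + l - n then z ^ n * lin ?A (?H k l) else 0)"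
      by (intro sum.cong) (simp_all add: coef_sconst_mult shpart.rep_eq coef_hpart)
    \<comment> \<open>At most one \<open>n\<close> projects onto the degree of \<open>w\<close>; if
      \<open>w\<close> is longer than \<open>k + l\<close>, there is none.\<close>
    also have "\<dots> = (\<Sum>n\<le>k + l. if length w \<le> k + l \<and> n = k + l - length w
        then z ^ (k + l - length w) * lin ?A (?H k l) else 0)"
      by (intro sum.cong) auto
    also have "\<dots> = (if length w \<le> k + l then z ^ (k + l - length w) * lin ?A (?H k l) else 0)"
      by (cases "length w \<le> k + l") simp_all
    also have "\<dots> = lin (\<lambda>s. if length w \<le> k + l then z ^ (k + l - length w) * ?A s else 0) (?H k l)"
      using lin_fun_mult[of "z ^ (k + l - length w)" ?A "?H k l"] by simp
    also have "\<dots> = lin (gutt_coef z w) (?H k l)"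
      unfolding lin_mult by (intro lin_hpart_cong) (simp add: gutt_coef_def)
    finally show ?thesis .
  qed
  then have "coef (tens_of (gutt_star z f g)) w
    = (\<Sum>k\<in>degrees f. \<Sum>l\<in>degrees g. lin (gutt_coef z w) (?H k l))"
    by (simp add: gutt_star_def coef_symt_sum)
  also have "\<dots> = lin (gutt_coef z w)
      ((\<Sum>k\<in>degrees f. hpart k (tens_of f)) * (\<Sum>l\<in>degrees g. hpart l (tens_of g)))"
    by (simp add: lin_sum sum_product)
  finally show ?thesis by (simp only: sum_hpart)
qed

lemma symt_eqI: "(\<And>w. coef (tens_of f) w = coef (tens_of g) w) \<Longrightarrow> f = g"
  by (metis poly_mapping_eqI tens_of_inject)

text \<open>The index set \<open>degrees f\<close> in the definition is not additive in
  \<open>f\<close>, so additivity is taken from the coefficient formula.\<close>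

lemma gutt_star_diff_left: "gutt_star z (f - f') g = gutt_star z f g - gutt_star z f' g"
  by (rule symt_eqI) (simp add: coef_gutt_star minus_symt.rep_eq lookup_minus left_diff_distrib lin_diff)

lemma gutt_star_diff_right: "gutt_star z f (g - g') = gutt_star z f g - gutt_star z f g'"
  by (rule symt_eqI) (simp add: coef_gutt_star minus_symt.rep_eq lookup_minus right_diff_distrib lin_diff)

text \<open>Both claims are proved in one induction: the vanishing above degree
  \<open>length s\<close> bounds the degree of every nonzero coefficient, and thus the factors that
  a further letter produces.\<close>

lemma actw_vac_bound:
  "norm (actw s vac a b c :: 'k::real_normed_field) * sqrt (fact (a + b)) \<le> 2 ^ length s * sqrt (fact (length s))"
  "length s < a + b + c \<Longrightarrow> actw s vac a b c = (0 :: 'k)"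
proof (induction s arbitrary: a b c)
  case Nil
  {
    case 1
    show ?case by (simp add: vac_def)
  next
    case 2
    then show ?case by (auto simp: vac_def)
  }
next
  case (Cons x s)
  let ?N = "length s" and ?\<phi> = "actw s vac :: nat \<Rightarrow> nat \<Rightarrow> nat \<Rightarrow> 'k"
  let ?B = "2 ^ ?N * sqrt (fact ?N)"
  {
    case 1
    \<comment> \<open>Multiplication by \<open>Q\<close> or \<open>P\<close> raises the degree, so
      the weight gains \<open>sqrt (Suc (a' + b'))\<close>.\<close>
    have up: "norm (?\<phi> a' b' c') * sqrt (fact (Suc (a' + b'))) \<le> ?B * sqrt (Suc ?N)" for a' b' c'
    proof (cases "?N < a' + b' + c'")
      case True
      then show ?thesis by (simp add: Cons.IH(2) del: fact_Suc)
    next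
      case False
      have "norm (?\<phi> a' b' c') * sqrt (fact (Suc (a' + b')))
        = (norm (?\<phi> a' b' c') * sqrt (fact (a' + b'))) * sqrt (Suc (a' + b'))"
        by (simp add: real_sqrt_mult fact_Suc del: of_nat_Suc)
      also have "\<dots> \<le> ?B * sqrt (Suc ?N)"
        using False by (intro mult_mono Cons.IH(1)) simp_all
      finally show ?thesis .
    qed
    \<comment> \<open>A derivative costs at most \<open>(n + 1) / 2\<close>, but the weight drops
      from \<open>sqrt (fact (n + 1))\<close> to \<open>sqrt (fact n)\<close>. The net cost is
      \<open>sqrt (n + 1) / 2\<close>.\<close>
    have down: "real (m + 1) / 2 * norm (?\<phi> a' b' c') * sqrt (fact n) \<le> ?B * sqrt (Suc ?N) / 2"
      if "a' + b' = Suc n" "m \<le> n" for a' b' c' m n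
    proof (cases "?N < a' + b' + c'")
      case True
      then show ?thesis by (simp add: Cons.IH(2))
    next
      case False
      have "real (m + 1) * norm (?\<phi> a' b' c') * sqrt (fact n)
        \<le> real (n + 1) * norm (?\<phi> a' b' c') * sqrt (fact n)"
        using that by (intro mult_right_mono) simp_all
      also have "\<dots> = (sqrt (Suc n) * sqrt (Suc n)) * norm (?\<phi> a' b' c') * sqrt (fact n)"
        by simp
      also have "\<dots> = (norm (?\<phi> a' b' c') * sqrt (fact (a' + b'))) * sqrt (Suc n)"
        unfolding that(1) by (simp add: real_sqrt_mult fact_Suc del: of_nat_Suc real_sqrt_mult_self)
      also have "\<dots> \<le> ?B * sqrt (Suc ?N)"
        using False that by (intro mult_mono Cons.IH(1)) simp_all
      finally show ?thesis by simp
    qed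
    have B: "2 ^ length (y # s) * sqrt (fact (length (y # s))) = 2 * (?B * sqrt (Suc ?N))" for y :: hbasis
      by (simp add: real_sqrt_mult fact_Suc del: of_nat_Suc)
    have pos: "0 \<le> ?B * sqrt (Suc ?N)" by simp
    \<comment> \<open>The two effects add up to a factor \<open>3/2\<close>, which is rounded up to
      the \<open>2\<close> per letter in the claim.\<close>
    have sum: "norm (u + v) * sqrt (fact (a + b)) \<le> 2 * (?B * sqrt (Suc ?N))"
      if "norm u * sqrt (fact (a + b)) \<le> ?B * sqrt (Suc ?N)"
        "norm v * sqrt (fact (a + b)) \<le> ?B * sqrt (Suc ?N) / 2" for u v :: 'k
    proof -
      have "norm (u + v) * sqrt (fact (a + b)) \<le> (norm u + norm v) * sqrt (fact (a + b))"
        by (intro mult_right_mono norm_triangle_ineq) simp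
      then show ?thesis using that pos unfolding distrib_right by linarith
    qed
    show ?case
    proof (cases x)
      case BQ
      have "norm (if a = 0 then 0 else ?\<phi> (a - 1) b c) * sqrt (fact (a + b)) \<le> ?B * sqrt (Suc ?N)"
        using up[of "a - 1" b c] pos by (cases a) (simp_all del: fact_Suc of_nat_Suc)
      moreover have "norm (- (if c = 0 then 0 else of_nat (b + 1) / 2 * ?\<phi> a (b + 1) (c - 1)))
          * sqrt (fact (a + b)) \<le> ?B * sqrt (Suc ?N) / 2"
        using down[of a "b + 1" "a + b" b "c - 1"] pos
        by (auto simp: norm_mult norm_divide simp del: of_nat_Suc of_nat_add)
      ultimately show ?thesis
        unfolding B BQ actw_simps act1.simps diff_conv_add_uminus by (rule sum)
    next
      case BP
      have "norm (if b = 0 then 0 else ?\<phi> a (b - 1) c) * sqrt (fact (a + b)) \<le> ?B * sqrt (Suc ?N)"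
        using up[of a "b - 1" c] pos by (cases b) (simp_all del: fact_Suc of_nat_Suc)
      moreover have "norm (if c = 0 then 0 else of_nat (a + 1) / 2 * ?\<phi> (a + 1) b (c - 1))
          * sqrt (fact (a + b)) \<le> ?B * sqrt (Suc ?N) / 2"
        using down[of "a + 1" b "a + b" a "c - 1"] pos
        by (auto simp: norm_mult norm_divide simp del: of_nat_Suc of_nat_add)
      ultimately show ?thesis
        unfolding B BP actw_simps act1.simps by (rule sum)
    next
      case BE
      have "norm (?\<phi> a b c') * sqrt (fact (a + b)) \<le> ?B * sqrt (Suc ?N)" for c'
      proof -
        have "norm (?\<phi> a b c') * sqrt (fact (a + b)) \<le> ?B" by (rule Cons.IH(1))
        also have "\<dots> \<le> ?B * sqrt (Suc ?N)" using mult_left_mono[of 1 "sqrt (Suc ?N)" ?B] by simp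
        finally show ?thesis .
      qed
      then have "norm (?\<phi> a b c') * sqrt (fact (a + b)) \<le> 2 * (?B * sqrt (Suc ?N))" for c'
        using pos by (smt (verit))
      then show ?thesis unfolding B BE actw_simps act1.simps using pos by simp
    qed
  next
    case 2
    then show ?case by (cases x) (auto simp: Cons.IH(2))
  }
qed

subsection \<open>Weighted estimates\<close>

text \<open>A weighted l1 norm of the coefficients. Since projective tensor powers of l1 norms are
  again l1 norms, such explicit norms can replace the seminorms defined by infima.\<close>

definition wnorm :: "(hbasis list \<Rightarrow> real) \<Rightarrow> 'k::real_normed_field tens \<Rightarrow> real" where
  "wnorm D t = (\<Sum>w\<in>Poly_Mapping.keys t. norm (coef t w) * D w)"

lemma wnorm_superset:
  assumes "finite A" "Poly_Mapping.keys t \<subseteq> A"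
  shows "wnorm D t = (\<Sum>w\<in>A. norm (coef t w) * D w)"
  unfolding wnorm_def using assms by (intro sum.mono_neutral_left) (auto simp: in_keys_iff)

lemma wnorm_0 [simp]: "wnorm D 0 = 0"
  by (simp add: wnorm_def)

lemma wnorm_tword [simp]: "wnorm D (tword w c) = norm c * D w"
  by (simp add: wnorm_def)

lemma wnorm_nonneg: "(\<And>w. 0 \<le> D w) \<Longrightarrow> 0 \<le> wnorm D t"
  by (simp add: wnorm_def sum_nonneg)

lemma wnorm_add:
  assumes "\<And>w. 0 \<le> D w"
  shows "wnorm D (s + t) \<le> wnorm D s + wnorm D t"
proof -
  let ?A = "Poly_Mapping.keys s \<union> Poly_Mapping.keys t"
  have "wnorm D (s + t) = (\<Sum>w\<in>?A. norm (coef s w + coef t w) * D w)"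
    using keys_add[of s t] by (subst wnorm_superset[of ?A]) (simp_all add: lookup_add)
  also have "\<dots> \<le> (\<Sum>w\<in>?A. norm (coef s w) * D w + norm (coef t w) * D w)"
    unfolding distrib_right[symmetric]
    by (intro sum_mono mult_right_mono norm_triangle_ineq assms)
  also have "\<dots> = wnorm D s + wnorm D t"
    by (subst (1 2) wnorm_superset[of ?A]) (simp_all add: sum.distrib)
  finally show ?thesis .
qed

lemma wnorm_sum:
  assumes "\<And>w. 0 \<le> D w"
  shows "wnorm D (sum f A) \<le> (\<Sum>x\<in>A. wnorm D (f x))"
proof (induction A rule: infinite_finite_induct)
  case (insert x A)
  then show ?case using wnorm_add[of D "f x" "sum f A"] assms by simp
qed simp_all

lemma wnorm_mono: "(\<And>w. w \<in> Poly_Mapping.keys t \<Longrightarrow> D w \<le> D' w) \<Longrightarrow> wnorm D t \<le> wnorm D' t"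
  unfolding wnorm_def by (intro sum_mono mult_left_mono) auto

lemma wnorm_mult:
  fixes s t :: "'k::real_normed_field tens"
  assumes "\<And>w. 0 \<le> D w" "\<And>u v. D (u @ v) \<le> D1 u * D2 v"
  shows "wnorm D (s * t) \<le> wnorm D1 s * wnorm D2 t"
proof -
  have "s * t = (\<Sum>u\<in>Poly_Mapping.keys s. \<Sum>v\<in>Poly_Mapping.keys t.
      tword (u @ v) (coef s u * coef t v))"
    by (subst (1) tens_expand[of s], subst (1) tens_expand[of t]) (simp add: sum_product tword_mult)
  then have "wnorm D (s * t) \<le> (\<Sum>u\<in>Poly_Mapping.keys s. wnorm D (\<Sum>v\<in>Poly_Mapping.keys t.
      tword (u @ v) (coef s u * coef t v)))"
    using assms(1) by (simp add: wnorm_sum)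
  also have "\<dots> \<le> (\<Sum>u\<in>Poly_Mapping.keys s. \<Sum>v\<in>Poly_Mapping.keys t.
      norm (coef s u * coef t v) * D (u @ v))"
    by (intro sum_mono order.trans[OF wnorm_sum] assms) simp
  also have "\<dots> \<le> (\<Sum>u\<in>Poly_Mapping.keys s. \<Sum>v\<in>Poly_Mapping.keys t.
      norm (coef s u * coef t v) * (D1 u * D2 v))"
    by (intro sum_mono mult_left_mono assms) simp
  also have "\<dots> = wnorm D1 s * wnorm D2 t"
    by (simp add: wnorm_def sum_product norm_mult mult_ac)
  finally show ?thesis .
qed

text \<open>Permuting letters preserves the length and hence the weight, and averaging does not
  increase the norm.\<close>

lemma wnorm_symmetrize:
  fixes t :: "'k::real_normed_field tens"
  assumes "\<And>w. 0 \<le> D w" "\<And>u v. length u = length v \<Longrightarrow> D u = D v"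
  shows "wnorm D (symmetrize t) \<le> wnorm D t"
proof -
  have "wnorm D (symmetrize t) \<le> (\<Sum>w\<in>Poly_Mapping.keys t. wnorm D (symmetrize (tword w (coef t w))))"
    by (subst tens_expand[of t]) (simp add: symmetrize_sum wnorm_sum assms(1))
  also have "\<dots> \<le> wnorm D t"
    unfolding wnorm_def[of D t]
  proof (rule sum_mono)
    fix w
    have "wnorm D (symmetrize (tword w (coef t w)))
      \<le> (\<Sum>\<sigma> | \<sigma> permutes {..<length w}. norm (coef t w / fact (length w)) * D (permute_list \<sigma> w))"
      unfolding symmetrize_tword by (intro order.trans[OF wnorm_sum] assms) simp
    also have "\<dots> = (\<Sum>\<sigma> | \<sigma> permutes {..<length w}. norm (coef t w / fact (length w)) * D w)"
      by (intro sum.cong arg_cong2[where f = "(*)"] assms(2)) simp_all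
    also have "\<dots> = norm (coef t w) * D w"
      by (simp add: card_permutations norm_divide norm_fact)
    finally show "wnorm D (symmetrize (tword w (coef t w))) \<le> norm (coef t w) * D w" .
  qed
  finally show ?thesis .
qed

text \<open>Distinct words may become equal once \<open>E\<close> is replaced by \<open>h\<close>;
  the triangle inequality accounts for this.\<close>

lemma wnorm_teval:
  assumes "\<And>w. 0 \<le> D w"
  shows "wnorm D (teval h t) \<le> wnorm (\<lambda>w. norm h ^ count_list w BE * D (filter (\<lambda>b. b \<noteq> BE) w)) t"
  unfolding teval_def
  by (rule order.trans[OF wnorm_sum[OF assms]])
    (simp add: wnorm_def[of _ t] norm_mult norm_power mult_ac)

section \<open>Factorial weights and the estimate of the star product\<close>

definition fweight :: "real \<Rightarrow> real \<Rightarrow> hbasis list \<Rightarrow> real" where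
  "fweight R c w = c ^ length w * fact (length w) powr R"

lemma fweight_nonneg: "0 \<le> c \<Longrightarrow> 0 \<le> fweight R c w"
  by (simp add: fweight_def)

text \<open>\<open>(k + l)!\<close> is at most \<open>2^(k+l) k! l!\<close>. The power of two,
  raised to \<open>R\<close>, is absorbed into the base of the geometric factor.\<close>

lemma fweight_append:
  assumes "0 \<le> c" "0 \<le> R"
  shows "fweight R c (u @ v) \<le> fweight R (c * 2 powr R) u * fweight R (c * 2 powr R) v"
proof -
  let ?k = "length u" and ?l = "length v"
  have "fact ?k * fact ?l * ((?k + ?l) choose ?k) = (fact (?k + ?l) :: nat)"
    using binomial_fact_lemma[of ?k "?k + ?l"] by simp
  then have "(fact (?k + ?l) :: real) = fact ?k * fact ?l * real ((?k + ?l) choose ?k)"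
    by (metis of_nat_fact of_nat_mult)
  also have "\<dots> \<le> fact ?k * fact ?l * 2 ^ (?k + ?l)"
    using of_nat_mono[OF binomial_le_pow2[of "?k + ?l" ?k], where 'a = real]
    by (intro mult_left_mono) simp_all
  finally have "(fact (?k + ?l) :: real) powr R \<le> (fact ?k * fact ?l * 2 ^ (?k + ?l)) powr R"
    using assms by (intro powr_mono2) simp_all
  also have "\<dots> = fact ?k powr R * fact ?l powr R * (2 powr R) ^ (?k + ?l)"
    by (simp add: powr_mult powr_power mult.commute flip: powr_realpow powr_powr)
      (simp add: powr_powr mult.commute)
  finally have "c ^ (?k + ?l) * fact (?k + ?l) powr R
      \<le> c ^ (?k + ?l) * (fact ?k powr R * fact ?l powr R * (2 powr R) ^ (?k + ?l))"
    using assms by (intro mult_left_mono) simp_all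
  then show ?thesis
    by (simp add: fweight_def power_mult_distrib power_add mult_ac)
qed

lemma length_filter_not_BE:
  "length (filter (\<lambda>b. b \<noteq> BE) w) = count_list w BQ + count_list w BP"
proof (induction w)
  case (Cons b w)
  then show ?case by (cases b) simp_all
qed simp

text \<open>A word \<open>s\<close> contributes only to words of length at most
  \<open>length s\<close>, so summing over them costs just a geometric factor.\<close>

lemma card_words_le: "card {w :: hbasis list. length w \<le> n} \<le> 4 ^ n"
proof -
  have card: "CARD(hbasis) = 3" by (simp add: UNIV_hbasis)
  have "card {w :: hbasis list. length w \<le> n} = (\<Sum>i\<le>n. 3 ^ i)"
    using card_lists_length_le[of "UNIV :: hbasis set" n] by (simp add: card)
  also have "\<dots> \<le> 4 ^ n"
  proof (induction n)
    case (Suc n)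
    have "(3::nat) ^ n \<le> 4 ^ n" by (rule power_mono) simp_all
    then show ?case using Suc by simp
  qed simp
  finally show ?thesis .
qed

lemma finite_words_le: "finite {w :: hbasis list. length w \<le> n}"
  using finite_lists_length_le[of "UNIV :: hbasis set" n] by simp

text \<open>Here \<open>R \<ge> 1 / 2\<close> enters. Of the weight \<open>d!^R\<close>, where
  \<open>d\<close> counts the letters \<open>Q\<close> and \<open>P\<close> in \<open>w\<close>, the
  part \<open>sqrt d!\<close> is controlled by \<open>actw_vac_bound\<close>. The remaining power
  has exponent \<open>R - 1/2 \<ge> 0\<close> and is monotone in \<open>d\<close>, which is at most
  \<open>length s\<close>.\<close>

lemma gutt_coef_bound:
  fixes z :: "'k::real_normed_field"
  assumes "R \<ge> 1 / 2" "1 \<le> x" "length w \<le> length s"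
  shows "norm (gutt_coef z w s) * (x ^ length w * fact (length (filter (\<lambda>b. b \<noteq> BE) w)) powr R)
    \<le> fweight R (2 * max 1 (norm z) * x) s"
proof -
  let ?N = "length s" and ?a = "count_list w BQ" and ?b = "count_list w BP" and ?c = "count_list w BE"
  let ?Z = "max 1 (norm z)" and ?A = "norm (actw s vac ?a ?b ?c :: 'k)"
  have le: "?a + ?b \<le> ?N"
    using assms(3) length_filter_le[of "\<lambda>b. b \<noteq> BE" w] by (simp add: length_filter_not_BE)
  have powr: "(fact n :: real) powr R = sqrt (fact n) * fact n powr (R - 1 / 2)" for n
    using powr_add[of "fact n :: real" "1 / 2" "R - 1 / 2"] by (simp add: powr_half_sqrt)
  have "norm (gutt_coef z w s) = norm z ^ (?N - length w) * (?A / norm (multinom ?a ?b ?c :: 'k))"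
    using assms(3) by (simp add: gutt_coef_def norm_mult norm_power norm_divide)
  also have "\<dots> \<le> ?Z ^ ?N * ?A"
  proof (intro mult_mono)
    have "norm z ^ (?N - length w) \<le> ?Z ^ (?N - length w)" by (intro power_mono) simp_all
    also have "\<dots> \<le> ?Z ^ ?N" by (intro power_increasing) simp_all
    finally show "norm z ^ (?N - length w) \<le> ?Z ^ ?N" .
    have "?A / norm (multinom ?a ?b ?c :: 'k) \<le> ?A / 1"
      by (intro divide_left_mono norm_multinom_ge_1) (simp_all add: multinom_nonzero)
    then show "?A / norm (multinom ?a ?b ?c :: 'k) \<le> ?A" by simp
  qed simp_all
  finally have 1: "norm (gutt_coef z w s) \<le> ?Z ^ ?N * ?A" .
  have 2: "x ^ length w \<le> x ^ ?N"
    using assms by (intro power_increasing) simp_all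
  have "?A * fact (?a + ?b) powr R = (?A * sqrt (fact (?a + ?b))) * fact (?a + ?b) powr (R - 1 / 2)"
    by (simp only: powr mult.assoc)
  also have "\<dots> \<le> (2 ^ ?N * sqrt (fact ?N)) * fact ?N powr (R - 1 / 2)"
    using assms le by (intro mult_mono actw_vac_bound powr_mono2 fact_mono) simp_all
  also have "\<dots> = 2 ^ ?N * fact ?N powr R"
    by (simp only: powr mult.assoc)
  finally have 3: "?A * fact (?a + ?b) powr R \<le> 2 ^ ?N * fact ?N powr R" .
  have "norm (gutt_coef z w s) * (x ^ length w * fact (?a + ?b) powr R)
    \<le> (?Z ^ ?N * ?A) * (x ^ ?N * fact (?a + ?b) powr R)"
    using 1 2 assms by (intro mult_mono) simp_all
  also have "\<dots> = (?Z ^ ?N * x ^ ?N) * (?A * fact (?a + ?b) powr R)" by (simp add: mult_ac)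
  also have "\<dots> \<le> (?Z ^ ?N * x ^ ?N) * (2 ^ ?N * fact ?N powr R)"
    using 3 assms by (intro mult_left_mono) simp_all
  also have "\<dots> = fweight R (2 * ?Z * x) s"
    by (simp add: fweight_def power_mult_distrib mult_ac)
  finally show ?thesis by (simp only: length_filter_not_BE)
qed

lemma wnorm_gutt_star:
  fixes z h :: "'k::real_normed_field"
  assumes "R \<ge> 1 / 2" "1 \<le> c"
  obtains C where "1 \<le> C"
    "\<And>f g. wnorm (fweight R c) (tens_of (seval h (gutt_star z f g)))
      \<le> wnorm (fweight R C) (tens_of f) * wnorm (fweight R C) (tens_of g)"
proof -
  define H Z where "H = max 1 (norm h)" and "Z = max 1 (norm z)"
  \<comment> \<open>\<open>D\<close> dominates the target weight after the substitution
    \<open>E = h\<close>: every letter pays a factor \<open>H\<close>, while only \<open>Q\<close>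
    and \<open>P\<close> count in the factorial.\<close>
  define D where "D w = (H * c) ^ length w * fact (length (filter (\<lambda>b. b \<noteq> BE) w)) powr R"
    for w :: "hbasis list"
  \<comment> \<open>The factor \<open>4\<close> pays for the number of output words and
    \<open>2 * Z\<close> for the star product; \<open>H * c\<close> is the base of
    \<open>D\<close>.\<close>
  define B where "B = 4 * (2 * Z * (H * c))"
  have ge: "1 \<le> H" "1 \<le> Z" "1 \<le> H * c" "0 \<le> H * c"
    using assms mult_mono[of 1 H 1 c] by (simp_all add: H_def Z_def)
  have D0: "0 \<le> D w" for w using ge by (simp add: D_def)
  have "1 * 1 \<le> (8 * Z) * (H * c)" using ge by (intro mult_mono) simp_all
  then have B: "1 \<le> B" by (simp add: B_def mult_ac)
  have eval: "wnorm (fweight R c) (tens_of (seval h y)) \<le> wnorm D (tens_of y)" for y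
  proof -
    have "wnorm (fweight R c) (tens_of (seval h y)) \<le> wnorm (fweight R c) (teval h (tens_of y))"
      unfolding seval.rep_eq using assms
      by (intro wnorm_symmetrize fweight_nonneg) (simp_all add: fweight_def)
    also have "\<dots> \<le> wnorm (\<lambda>w. norm h ^ count_list w BE * fweight R c (filter (\<lambda>b. b \<noteq> BE) w)) (tens_of y)"
      using assms by (intro wnorm_teval fweight_nonneg) simp
    also have "\<dots> \<le> wnorm D (tens_of y)"
    proof (rule wnorm_mono)
      fix w
      have "norm h ^ count_list w BE \<le> H ^ count_list w BE"
        by (intro power_mono) (simp_all add: H_def)
      also have "\<dots> \<le> H ^ length w"
        using ge by (intro power_increasing count_le_length) simp_all
      finally have "norm h ^ count_list w BE * c ^ length (filter (\<lambda>b. b \<noteq> BE) w)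
          \<le> H ^ length w * c ^ length w"
        using assms ge by (intro mult_mono power_increasing length_filter_le) simp_all
      then show "norm h ^ count_list w BE * fweight R c (filter (\<lambda>b. b \<noteq> BE) w) \<le> D w"
        unfolding D_def fweight_def power_mult_distrib mult.assoc[symmetric]
        by (rule mult_right_mono) simp
    qed
    finally show ?thesis .
  qed
  have star: "wnorm D (tens_of (gutt_star z f g)) \<le> wnorm (fweight R B) (tens_of f * tens_of g)" for f g
  proof -
    let ?Y = "Poly_Mapping.keys (tens_of (gutt_star z f g))" and ?t = "tens_of f * tens_of g"
    have "wnorm D (tens_of (gutt_star z f g))
      \<le> (\<Sum>w\<in>?Y. (\<Sum>s\<in>Poly_Mapping.keys ?t. norm (coef ?t s) * norm (gutt_coef z w s)) * D w)"
      unfolding wnorm_def coef_gutt_star lin_def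
      by (intro sum_mono mult_right_mono D0 order.trans[OF norm_sum]) (simp add: norm_mult)
    \<comment> \<open>With the sums exchanged, the contributions of each input word \<open>s\<close>
      can be estimated separately.\<close>
    also have "\<dots> = (\<Sum>s\<in>Poly_Mapping.keys ?t. norm (coef ?t s) * (\<Sum>w\<in>?Y. norm (gutt_coef z w s) * D w))"
      by (simp add: sum_distrib_left sum_distrib_right mult.assoc) (rule sum.swap)
    also have "\<dots> \<le> (\<Sum>s\<in>Poly_Mapping.keys ?t. norm (coef ?t s) * fweight R B s)"
    proof (intro sum_mono mult_left_mono)
      fix s :: "hbasis list"
      let ?W = "{w :: hbasis list. length w \<le> length s}"
      have "(\<Sum>w\<in>?Y. norm (gutt_coef z w s) * D w) = (\<Sum>w\<in>?Y \<inter> ?W. norm (gutt_coef z w s) * D w)"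
        by (intro sum.mono_neutral_right) (auto simp: gutt_coef_def)
      also have "\<dots> \<le> (\<Sum>w\<in>?W. norm (gutt_coef z w s) * D w)"
        by (intro sum_mono2 finite_words_le) (auto simp: D0)
      also have "\<dots> \<le> (\<Sum>w\<in>?W. fweight R (2 * Z * (H * c)) s)"
        unfolding D_def Z_def using ge assms by (intro sum_mono gutt_coef_bound) simp_all
      also have "\<dots> \<le> real (4 ^ length s) * fweight R (2 * Z * (H * c)) s"
        using ge card_words_le[of "length s"]
        by (simp, intro mult_right_mono fweight_nonneg) (simp_all flip: of_nat_power_le_of_nat_cancel_iff)
      also have "\<dots> = fweight R B s"
        by (simp only: fweight_def B_def power_mult_distrib of_nat_power of_nat_numeral mult.assoc)
      finally show "(\<Sum>w\<in>?Y. norm (gutt_coef z w s) * D w) \<le> fweight R B s" .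
    qed simp
    finally show ?thesis by (simp only: wnorm_def)
  qed
  have "1 * 1 \<le> B * 2 powr R" using B assms by (intro mult_mono) (simp_all add: ge_one_powr_ge_zero)
  then have "1 \<le> B * 2 powr R" by simp
  moreover have "wnorm (fweight R c) (tens_of (seval h (gutt_star z f g)))
      \<le> wnorm (fweight R (B * 2 powr R)) (tens_of f) * wnorm (fweight R (B * 2 powr R)) (tens_of g)" for f g
  proof -
    have "wnorm (fweight R B) (tens_of f * tens_of g)
      \<le> wnorm (fweight R (B * 2 powr R)) (tens_of f) * wnorm (fweight R (B * 2 powr R)) (tens_of g)"
      using B assms by (intro wnorm_mult fweight_append fweight_nonneg) simp_all
    then show ?thesis using eval star by (meson order.trans)
  qed
  ultimately show ?thesis by (rule that)
qed

subsection \<open>Projective seminorms and continuity\<close>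

lemma seminorm_zero: "seminorm p \<Longrightarrow> p 0 = 0"
  unfolding seminorm_def by (metis mult_zero_left norm_zero vector_smult_lzero)

lemma seminorm_nonneg:
  assumes "seminorm p"
  shows "0 \<le> p x"
proof -
  have "p (- x) = p x"
    using assms unfolding seminorm_def by (metis norm_minus_cancel norm_one mult_1 vector_sneg_minus1)
  moreover have "p (x + - x) \<le> p x + p (- x)"
    using assms unfolding seminorm_def by blast
  ultimately show ?thesis using seminorm_zero[OF assms] by simp
qed

text \<open>The decompositions into elementary tensors over which the projective seminorm takes its
  infimum.\<close>

definition is_rep :: "nat \<Rightarrow> ('k::comm_ring_1 ^ hbasis) list list \<Rightarrow> 'k tens \<Rightarrow> bool" where
  "is_rep n vss f \<longleftrightarrow> (\<forall>vs\<in>set vss. length vs = n) \<and> f = (\<Sum>vs\<leftarrow>vss. \<Prod>v\<leftarrow>vs. tvec v)"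

definition rep_cost :: "('v \<Rightarrow> real) \<Rightarrow> 'v list list \<Rightarrow> real" where
  "rep_cost p vss = (\<Sum>vs\<leftarrow>vss. \<Prod>v\<leftarrow>vs. p v)"

lemma tensor_power_seminorm_eq:
  "n \<noteq> 0 \<Longrightarrow> tensor_power_seminorm p n f = Inf {rep_cost p vss | vss. is_rep n vss f}"
  by (simp add: tensor_power_seminorm_def rep_cost_def is_rep_def)

lemma prod_list_nonneg: "(\<And>v. 0 \<le> p v) \<Longrightarrow> 0 \<le> (\<Prod>v\<leftarrow>vs. p v :: real)"
  by (induction vs) simp_all

lemma rep_cost_nonneg: "(\<And>v. 0 \<le> p v) \<Longrightarrow> 0 \<le> rep_cost p vss"
  unfolding rep_cost_def by (rule sum_list_nonneg) (auto intro: prod_list_nonneg)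

lemma tensor_power_seminorm_le_cost:
  assumes "seminorm p" "n \<noteq> 0" "is_rep n vss f"
  shows "tensor_power_seminorm p n f \<le> rep_cost p vss"
  unfolding tensor_power_seminorm_eq[OF assms(2)]
  using assms(3) rep_cost_nonneg[of p] seminorm_nonneg[OF assms(1)]
  by (intro cInf_lower bdd_belowI[of _ 0]) auto

text \<open>The expansion into words is such a decomposition. Each coefficient is absorbed into the
  first factor, which exists because \<open>n \<noteq> 0\<close>.\<close>

lemma exists_rep:
  fixes f :: "'k::real_normed_field tens"
  assumes "seminorm p" "\<And>b. p (axis b 1) \<le> c" "n \<noteq> 0" "\<forall>w\<in>Poly_Mapping.keys f. length w = n"
  obtains vss where "is_rep n vss f" "rep_cost p vss \<le> wnorm (\<lambda>w. c ^ length w) f"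
proof -
  obtain ws where ws: "set ws = Poly_Mapping.keys f" "distinct ws"
    using finite_distinct_list[OF finite_keys[of f]] by metis
  let ?v = "\<lambda>w. axis (hd w) (coef f w) # map (\<lambda>b. axis b 1) (tl w)"
  have ne: "w \<noteq> []" "length w = n" if "w \<in> set ws" for w
    using that assms(3,4) ws by auto
  have c: "0 \<le> c" using seminorm_nonneg[OF assms(1), of "axis BQ 1"] assms(2)[of BQ] by linarith
  have tw: "(\<Prod>v\<leftarrow>?v w. tvec v) = tword w (coef f w)" if "w \<in> set ws" for w
    using ne[OF that] prod_list_tvec_axis[of "tl w", where 'k = 'k]
    by (simp add: tvec_axis o_def tword_mult)
  have cost: "(\<Prod>v\<leftarrow>?v w. p v) \<le> norm (coef f w) * c ^ length w" if "w \<in> set ws" for w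
  proof -
    have letters: "(\<Prod>b\<leftarrow>u. p (axis b 1)) \<le> c ^ length u" for u
    proof (induction u)
      case (Cons b u)
      then show ?case using assms(2)[of b] c seminorm_nonneg[OF assms(1)]
        by (simp, intro mult_mono) (auto intro: prod_list_nonneg)
    qed simp
    have "p (axis (hd w) 1) * (\<Prod>b\<leftarrow>tl w. p (axis b 1)) \<le> c * c ^ length (tl w)"
      using assms(2) c seminorm_nonneg[OF assms(1)] by (intro mult_mono prod_list_nonneg letters) auto
    also have "\<dots> = c ^ length w" using ne(1)[OF that] by (cases w) simp_all
    finally have *: "p (axis (hd w) 1) * (\<Prod>b\<leftarrow>tl w. p (axis b 1)) \<le> c ^ length w" .
    have "axis (hd w) (coef f w) = coef f w *s axis (hd w) 1"
      by (simp add: vec_eq_iff axis_def)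
    then have "p (axis (hd w) (coef f w)) = norm (coef f w) * p (axis (hd w) 1)"
      using assms(1) by (simp add: seminorm_def)
    then show ?thesis using mult_left_mono[OF *, of "norm (coef f w)"]
      by (simp add: o_def mult.assoc)
  qed
  show ?thesis
  proof (rule that)
    have "(\<Sum>vs\<leftarrow>map ?v ws. \<Prod>v\<leftarrow>vs. tvec v) = (\<Sum>w\<leftarrow>ws. tword w (coef f w))"
      unfolding map_map o_def using tw by (intro arg_cong[where f = sum_list] map_cong refl)
    also have "\<dots> = f"
      using ws tens_expand[of f] by (simp add: sum_list_distinct_conv_sum_set)
    finally show "is_rep n (map ?v ws) f"
      using ne assms(3) unfolding is_rep_def by auto
    have "rep_cost p (map ?v ws) \<le> (\<Sum>w\<leftarrow>ws. norm (coef f w) * c ^ length w)"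
      unfolding rep_cost_def map_map o_def using cost by (intro sum_list_mono)
    then show "rep_cost p (map ?v ws) \<le> wnorm (\<lambda>w. c ^ length w) f"
      using ws by (simp add: wnorm_def sum_list_distinct_conv_sum_set)
  qed
qed

lemma wnorm_degree_0:
  assumes "\<forall>w\<in>Poly_Mapping.keys f. length w = 0"
  shows "wnorm (\<lambda>w. c ^ length w) f = norm (coef f [])"
  using assms by (subst wnorm_superset[of "{[]}"]) auto

lemma tensor_power_seminorm_le_wnorm:
  fixes f :: "'k::real_normed_field tens"
  assumes "seminorm p" "\<And>b. p (axis b 1) \<le> c" "\<forall>w\<in>Poly_Mapping.keys f. length w = n"
  shows "tensor_power_seminorm p n f \<le> wnorm (\<lambda>w. c ^ length w) f"
proof (cases "n = 0")
  case True
  then show ?thesis using assms(3) by (simp add: tensor_power_seminorm_def wnorm_degree_0)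
next
  case False
  obtain vss where vss: "is_rep n vss f" "rep_cost p vss \<le> wnorm (\<lambda>w. c ^ length w) f"
    by (rule exists_rep[OF assms(1,2) False assms(3)])
  show ?thesis
    using tensor_power_seminorm_le_cost[OF assms(1) False vss(1)] vss(2) by (rule order.trans)
qed

definition l1 :: "real \<Rightarrow> 'k::real_normed_field ^ hbasis \<Rightarrow> real" where
  "l1 c v = c * (\<Sum>b\<in>UNIV. norm (v $ b))"

lemma seminorm_l1: "0 \<le> c \<Longrightarrow> seminorm (l1 c)"
  unfolding seminorm_def l1_def
  by (auto simp: norm_mult sum_distrib_left mult_ac simp flip: sum.distrib distrib_left
      intro!: mult_left_mono sum_mono norm_triangle_ineq)

lemma continuous_l1: "continuous_on UNIV (l1 c)"
  unfolding l1_def by (intro continuous_intros)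

lemma wnorm_tvec_le: "0 \<le> c \<Longrightarrow> wnorm (\<lambda>w. c ^ length w) (tvec v) \<le> l1 c v"
  unfolding tvec_def l1_def sum_distrib_left
  by (rule order.trans[OF wnorm_sum]) (simp_all add: mult.commute)

text \<open>The norm on the left is subadditive, submultiplicative for the tensor product, and at
  most \<open>l1 c\<close> on vectors. So no decomposition can be cheaper.\<close>

lemma wnorm_le_rep_cost:
  assumes "0 \<le> c" "is_rep n vss f"
  shows "wnorm (\<lambda>w. c ^ length w) f \<le> rep_cost (l1 c) vss"
proof -
  have prod: "wnorm (\<lambda>w. c ^ length w) (\<Prod>v\<leftarrow>vs. tvec v) \<le> (\<Prod>v\<leftarrow>vs. l1 c v)" for vs :: "('a ^ hbasis) list"
  proof (induction vs)
    case Nil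
    have 1: "(1 :: 'a tens) = tword [] 1" by (simp flip: single_one zero_list_def)
    show ?case unfolding list.map prod_list.Nil 1 wnorm_tword by simp
  next
    case (Cons v vs)
    have "wnorm (\<lambda>w. c ^ length w) (tvec v * (\<Prod>v\<leftarrow>vs. tvec v))
      \<le> wnorm (\<lambda>w. c ^ length w) (tvec v) * wnorm (\<lambda>w. c ^ length w) (\<Prod>v\<leftarrow>vs. tvec v)"
      using assms by (intro wnorm_mult) (simp_all add: power_add)
    also have "\<dots> \<le> l1 c v * (\<Prod>v\<leftarrow>vs. l1 c v)"
      using assms Cons.IH seminorm_nonneg[OF seminorm_l1, of c]
      by (intro mult_mono wnorm_tvec_le wnorm_nonneg) auto
    finally show ?case by simp
  qed
  have "wnorm (\<lambda>w. c ^ length w) (\<Sum>vs\<leftarrow>vss. \<Prod>v\<leftarrow>vs. tvec v) \<le> rep_cost (l1 c) vss"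
  proof (induction vss)
    case (Cons vs vss)
    have "wnorm (\<lambda>w. c ^ length w) (\<Sum>vs\<leftarrow>vs # vss. \<Prod>v\<leftarrow>vs. tvec v)
      \<le> wnorm (\<lambda>w. c ^ length w) (\<Prod>v\<leftarrow>vs. tvec v) + wnorm (\<lambda>w. c ^ length w) (\<Sum>vs\<leftarrow>vss. \<Prod>v\<leftarrow>vs. tvec v)"
      using assms(1) by (simp add: wnorm_add)
    also have "\<dots> \<le> rep_cost (l1 c) (vs # vss)"
      using prod[of vs] Cons.IH by (simp add: rep_cost_def)
    finally show ?case .
  qed (simp add: rep_cost_def)
  then show ?thesis using assms(2) by (simp add: is_rep_def)
qed

lemma wnorm_le_tensor_power_seminorm:
  fixes f :: "'a::real_normed_field tens"
  assumes "0 \<le> c" "\<forall>w\<in>Poly_Mapping.keys f. length w = n"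
  shows "wnorm (\<lambda>w. c ^ length w) f \<le> tensor_power_seminorm (l1 c) n f"
proof (cases "n = 0")
  case True
  then show ?thesis using assms(2) by (simp add: tensor_power_seminorm_def wnorm_degree_0)
next
  case False
  have "l1 c (axis b 1 :: 'a ^ hbasis) \<le> c" for b :: hbasis
  proof -
    have "(\<Sum>b'\<in>UNIV. norm ((axis b 1 :: 'a ^ hbasis) $ b')) = (\<Sum>b'\<in>UNIV. if b' = b then 1 else 0)"
      by (intro sum.cong) (auto simp: axis_def)
    then show ?thesis by (simp add: l1_def)
  qed
  \<comment> \<open>A bound from below for the infimum requires that some decomposition
    exists.\<close>
  then obtain vss where "is_rep n vss f"
    using exists_rep[OF seminorm_l1[OF assms(1)] _ False assms(2)] by (metis (no_types))
  then show ?thesis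
    unfolding tensor_power_seminorm_eq[OF False]
    by (intro cInf_greatest) (auto intro: wnorm_le_rep_cost[OF assms(1)])
qed

section \<open>Comparison of the seminorms \<open>p_R\<close> with weighted l1 norms\<close>

lemma wnorm_fweight:
  "wnorm (fweight R c) (tens_of f)
    = (\<Sum>n\<in>degrees f. fact n powr R * wnorm (\<lambda>w. c ^ length w) (hpart n (tens_of f)))"
proof -
  let ?K = "Poly_Mapping.keys (tens_of f)"
  have "wnorm (fweight R c) (tens_of f)
    = (\<Sum>n\<in>degrees f. \<Sum>w\<in>{w \<in> ?K. length w = n}. norm (coef (tens_of f) w) * fweight R c w)"
    unfolding wnorm_def degrees_def by (rule sum.image_gen) simp
  also have "\<dots> = (\<Sum>n\<in>degrees f. fact n powr R * wnorm (\<lambda>w. c ^ length w) (hpart n (tens_of f)))"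
    by (intro sum.cong refl)
      (auto simp: wnorm_def keys_hpart sum_distrib_left coef_hpart fweight_def mult_ac intro!: sum.cong)
  finally show ?thesis .
qed

lemma seminorm_R_le_wnorm:
  assumes "seminorm p" "\<And>b. p (axis b 1) \<le> c"
  shows "seminorm_R R p f \<le> wnorm (fweight R c) (tens_of f)"
  unfolding seminorm_R_def wnorm_fweight shpart.rep_eq using assms
  by (intro sum_mono mult_left_mono tensor_power_seminorm_le_wnorm) (simp_all add: keys_hpart)

lemma wnorm_le_seminorm_R:
  assumes "0 \<le> c"
  shows "wnorm (fweight R c) (tens_of f) \<le> seminorm_R R (l1 c) f"
  unfolding seminorm_R_def wnorm_fweight shpart.rep_eq using assms
  by (intro sum_mono mult_left_mono wnorm_le_tensor_power_seminorm) (simp_all add: keys_hpart)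

lemma tensor_power_seminorm_zero:
  assumes "seminorm p"
  shows "tensor_power_seminorm p n 0 = 0"
proof (cases "n = 0")
  case False
  have rep: "is_rep n [] (0 :: 'a tens)" by (simp add: is_rep_def)
  then have "tensor_power_seminorm p n 0 \<le> 0"
    using tensor_power_seminorm_le_cost[OF assms False rep] by (simp add: rep_cost_def)
  moreover have "0 \<le> tensor_power_seminorm p n 0"
    unfolding tensor_power_seminorm_eq[OF False]
    using rep by (intro cInf_greatest) (auto intro: rep_cost_nonneg seminorm_nonneg[OF assms])
  ultimately show ?thesis by simp
qed (simp add: tensor_power_seminorm_def)

text \<open>Decompositions of \<open>f\<close> and \<open>g\<close> concatenate to one of
  \<open>f + g\<close>. Homogeneity ensures that both infima range over nonempty sets.\<close>

lemma tensor_power_seminorm_add: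
  fixes f g :: "'k::real_normed_field tens"
  assumes p: "seminorm p"
    and fg: "\<forall>w\<in>Poly_Mapping.keys f. length w = n" "\<forall>w\<in>Poly_Mapping.keys g. length w = n"
  shows "tensor_power_seminorm p n (f + g) \<le> tensor_power_seminorm p n f + tensor_power_seminorm p n g"
proof (cases "n = 0")
  case True
  then show ?thesis by (simp add: tensor_power_seminorm_def lookup_add norm_triangle_ineq)
next
  case False
  let ?S = "\<lambda>f. {rep_cost p vss | vss. is_rep n vss f}"
  have "p (axis b 1) \<le> (\<Sum>b\<in>UNIV. p (axis b 1))" for b :: hbasis
    by (rule member_le_sum) (simp_all add: seminorm_nonneg[OF p])
  then have ne: "?S f \<noteq> {}" if "\<forall>w\<in>Poly_Mapping.keys f. length w = n" for f
    by (rule exists_rep[OF p _ False that]) blast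
  have le: "tensor_power_seminorm p n (f + g) \<le> x + y" if xy: "x \<in> ?S f" "y \<in> ?S g" for x y
  proof -
    obtain us vs where "x = rep_cost p us" "is_rep n us f" "y = rep_cost p vs" "is_rep n vs g"
      using xy by blast
    then have "is_rep n (us @ vs) (f + g)" "rep_cost p (us @ vs) = x + y"
      by (auto simp: is_rep_def rep_cost_def)
    then show ?thesis using tensor_power_seminorm_le_cost[OF p False] by metis
  qed
  have "tensor_power_seminorm p n (f + g) - y \<le> tensor_power_seminorm p n f" if "y \<in> ?S g" for y
    unfolding tensor_power_seminorm_eq[OF False, of p f]
    using le[OF _ that] by (intro cInf_greatest ne fg) (simp add: diff_le_eq)
  then have "tensor_power_seminorm p n (f + g) - tensor_power_seminorm p n f \<le> y" if "y \<in> ?S g" for y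
    using that by fastforce
  then have "tensor_power_seminorm p n (f + g) - tensor_power_seminorm p n f \<le> tensor_power_seminorm p n g"
    unfolding tensor_power_seminorm_eq[OF False, of p g] by (intro cInf_greatest ne fg)
  then show ?thesis by simp
qed

text \<open>A common finite index set allows \<open>f\<close>, \<open>g\<close> and
  \<open>f + g\<close> to be compared degree by degree, even when homogeneous parts cancel.\<close>

lemma seminorm_R_superset:
  assumes "seminorm p" "finite S" "degrees f \<subseteq> S"
  shows "seminorm_R R p f = (\<Sum>n\<in>S. fact n powr R * tensor_power_seminorm p n (hpart n (tens_of f)))"
  unfolding seminorm_R_def shpart.rep_eq
proof (intro sum.mono_neutral_left ballI assms)
  fix n assume "n \<in> S - degrees f"
  then have "Poly_Mapping.keys (hpart n (tens_of f)) = {}"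
    by (auto simp: keys_hpart degrees_def)
  then have "hpart n (tens_of f) = 0" by simp
  then show "fact n powr R * tensor_power_seminorm p n (hpart n (tens_of f)) = 0"
    by (simp add: tensor_power_seminorm_zero[OF assms(1)])
qed

lemma seminorm_R_add:
  assumes p: "seminorm p"
  shows "seminorm_R R p (f + g) \<le> seminorm_R R p f + seminorm_R R p g"
proof -
  let ?S = "degrees f \<union> degrees g"
  have "degrees (f + g) \<subseteq> ?S"
    using keys_add[of "tens_of f" "tens_of g"] by (auto simp: degrees_def plus_symt.rep_eq)
  then have "seminorm_R R p (f + g)
    = (\<Sum>n\<in>?S. fact n powr R * tensor_power_seminorm p n (hpart n (tens_of f) + hpart n (tens_of g)))"
    by (subst seminorm_R_superset[OF p, of ?S])
      (auto simp: finite_degrees plus_symt.rep_eq lookup_add coef_hpart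
        intro!: sum.cong arg_cong2[where f = "tensor_power_seminorm p"] poly_mapping_eqI)
  also have "\<dots> \<le> (\<Sum>n\<in>?S. fact n powr R * (tensor_power_seminorm p n (hpart n (tens_of f))
      + tensor_power_seminorm p n (hpart n (tens_of g))))"
    by (intro sum_mono mult_left_mono tensor_power_seminorm_add p) (simp_all add: keys_hpart)
  also have "\<dots> = seminorm_R R p f + seminorm_R R p g"
    by (subst (1 2) seminorm_R_superset[OF p, of ?S])
      (simp_all add: finite_degrees distrib_left sum.distrib)
  finally show ?thesis .
qed

lemma seminorm_R_0: "seminorm_R R p 0 = 0"
  by (simp add: seminorm_R_def degrees_def zero_symt.rep_eq)

section \<open>The topology generated by the seminorms \<open>p_R\<close>\<close>

lemma l1_R_seminorms: "0 \<le> c \<Longrightarrow> seminorm_R R (l1 c) \<in> R_seminorms R"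
  unfolding R_seminorms_def using seminorm_l1 continuous_l1 by blast

text \<open>The balls form a subbasis, so their union is the underlying set of the topology. Each
  point is covered by a ball centred at itself.\<close>

lemma Union_seminorm_balls:
  "\<Union> {{y \<in> V. p (y - x) < \<epsilon>} | p x \<epsilon>. p \<in> R_seminorms R \<and> x \<in> V \<and> 0 < \<epsilon>} = V"
proof
  show "V \<subseteq> \<Union> {{y \<in> V. p (y - x) < \<epsilon>} | p x \<epsilon>. p \<in> R_seminorms R \<and> x \<in> V \<and> 0 < \<epsilon>}"
  proof
    fix y assume y: "y \<in> V"
    let ?U = "{y' \<in> V. seminorm_R R (l1 1) (y' - y) < 1}"
    have "?U \<in> {{y \<in> V. p (y - x) < \<epsilon>} | p x \<epsilon>. p \<in> R_seminorms R \<and> x \<in> V \<and> 0 < \<epsilon>}"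
      using y l1_R_seminorms[of 1 R] by (auto intro!: exI[of _ "seminorm_R R (l1 1)"] exI[of _ y] exI[of _ "1::real"])
    moreover have "y \<in> ?U" using y by (simp add: seminorm_R_0)
    ultimately show "y \<in> \<Union> {{y \<in> V. p (y - x) < \<epsilon>} | p x \<epsilon>. p \<in> R_seminorms R \<and> x \<in> V \<and> 0 < \<epsilon>}"
      by blast
  qed
qed auto

lemma topspace_sym_topology [simp]: "topspace (sym_topology R) = UNIV"
  unfolding sym_topology_def seminorm_topology_def topology_generated_by_topspace
  by (rule Union_seminorm_balls)

lemma openin_sym_topology_ball:
  assumes "0 \<le> c" "0 < \<epsilon>"
  shows "openin (sym_topology R) {f. seminorm_R R (l1 c) (f - f0) < \<epsilon>}"
  unfolding sym_topology_def seminorm_topology_def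
  using l1_R_seminorms[OF assms(1), of R] assms(2)
  by (intro topology_generated_by_Basis) auto

lemma seval_diff: "seval h (f - g) = seval h f - seval h g"
  using seval_add[of h "f - g" g] by simp

theorem proposition6p3p2:
  fixes h z :: "'k::real_normed_field" and R :: real
  assumes "R \<ge> 1 / 2"
  shows "continuous_map (prod_topology (sym_topology R) (sym_topology R)) (weyl_topology R h)
           (\<lambda>(f, g). weyl_proj h (gutt_star z f g))"
proof -
  let ?T = "prod_topology (sym_topology R) (sym_topology R) :: ('k symt \<times> 'k symt) topology"
  \<comment> \<open>\<open>F\<close> is the map in the statement, read in the representatives from
    \<open>sym_QP\<close>.\<close>
  define F where "F f g = seval h (gutt_star z f g)" for f g
  have F_diff: "F (f - f') g = F f g - F f' g" "F f (g - g') = F f g - F f g'" for f f' g g'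
    by (simp_all add: F_def gutt_star_diff_left gutt_star_diff_right seval_diff)
  have "continuous_map ?T (seminorm_topology sym_QP (R_seminorms R)) (\<lambda>(f, g). F f g)"
    unfolding seminorm_topology_def
  proof (rule continuous_on_generated_topo)
    fix U :: "'k symt set" assume "U \<in> {{y \<in> sym_QP. p (y - x) < \<epsilon>} | p x \<epsilon>.
      p \<in> R_seminorms R \<and> x \<in> sym_QP \<and> (0::real) < \<epsilon>}"
    then obtain p x \<epsilon> where U: "U = {y \<in> sym_QP. seminorm_R R p (y - x) < \<epsilon>}"
      and p: "seminorm p" and "0 < \<epsilon>" "x \<in> sym_QP"
      by (auto simp: R_seminorms_def)
    \<comment> \<open>\<open>c\<close> bounds \<open>p\<close> on all basis vectors and is at least
      \<open>1\<close>, as \<open>wnorm_gutt_star\<close> demands.\<close>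
    define c where "c = max 1 (\<Sum>b\<in>UNIV. p (axis b 1))"
    have pc: "p (axis b 1) \<le> c" for b
      using member_le_sum[of b UNIV "\<lambda>b. p (axis b 1)"] seminorm_nonneg[OF p]
      by (simp add: c_def max.coboundedI2)
    obtain C where C: "1 \<le> C" "\<And>f g. wnorm (fweight R c) (tens_of (F f g))
      \<le> wnorm (fweight R C) (tens_of f) * wnorm (fweight R C) (tens_of g)"
      using wnorm_gutt_star[OF assms, of c h z] unfolding F_def c_def by auto
    let ?q = "seminorm_R R (l1 C) :: 'k symt \<Rightarrow> real"
    have q0: "0 \<le> ?q f" for f
      using wnorm_le_seminorm_R[of C R f] wnorm_nonneg[of "fweight R C" "tens_of f"] C(1)
      by (simp add: fweight_nonneg order.trans)
    have bound: "seminorm_R R p (F f g) \<le> ?q f * ?q g" for f g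
    proof -
      have "seminorm_R R p (F f g) \<le> wnorm (fweight R c) (tens_of (F f g))"
        by (rule seminorm_R_le_wnorm[OF p pc])
      also have "\<dots> \<le> wnorm (fweight R C) (tens_of f) * wnorm (fweight R C) (tens_of g)"
        by (rule C(2))
      also have "\<dots> \<le> ?q f * ?q g"
        using C(1) q0 by (intro mult_mono wnorm_le_seminorm_R wnorm_nonneg fweight_nonneg) simp_all
      finally show ?thesis .
    qed
    let ?P = "(\<lambda>(f, g). F f g) -` U \<inter> topspace ?T"
    show "openin ?T ?P"
    proof (subst openin_subopen, intro ballI)
      fix fg assume "fg \<in> ?P"
      then obtain f0 g0 where fg: "fg = (f0, g0)" and lt: "seminorm_R R p (F f0 g0 - x) < \<epsilon>"
        by (cases fg) (auto simp: U)
      define \<eta> where "\<eta> = \<epsilon> - seminorm_R R p (F f0 g0 - x)"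
      define A where "A = 1 + ?q f0 + ?q g0"
      \<comment> \<open>By biadditivity the deviation is at most
        \<open>\<delta>\<cdot>\<delta> + \<delta> ?q g0 + ?q f0 \<delta>\<close>. As
        \<open>\<delta> \<le> 1\<close>, this is at most \<open>\<delta> A\<close>, and the second
        entry of the minimum makes it at most \<open>\<eta> / 2\<close>.\<close>
      define \<delta> where "\<delta> = min 1 (\<eta> / (2 * A))"
      have pos: "0 < \<eta>" "0 < A" using lt q0[of f0] q0[of g0] by (simp_all add: \<eta>_def A_def)
      then have \<delta>: "0 < \<delta>" "\<delta> \<le> 1" by (simp_all add: \<delta>_def)
      have "\<delta> * A \<le> \<eta> / (2 * A) * A" using pos by (intro mult_right_mono) (simp_all add: \<delta>_def)
      then have \<delta>A: "\<delta> * A < \<eta>" using pos by simp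
      let ?B = "{f. ?q (f - f0) < \<delta>} \<times> {g. ?q (g - g0) < \<delta>}"
      have "?B \<subseteq> ?P"
      proof
        fix fg' assume "fg' \<in> ?B"
        then obtain f g where fg': "fg' = (f, g)" and f: "?q (f - f0) < \<delta>" and g: "?q (g - g0) < \<delta>"
          by auto
        have "F f g - x = (F f0 g0 - x) + (F (f - f0) (g - g0) + (F (f - f0) g0 + F f0 (g - g0)))"
          by (simp add: F_diff)
        then have "seminorm_R R p (F f g - x) \<le> seminorm_R R p (F f0 g0 - x)
          + (seminorm_R R p (F (f - f0) (g - g0)) + (seminorm_R R p (F (f - f0) g0)
          + seminorm_R R p (F f0 (g - g0))))"
          by (smt (verit) seminorm_R_add[OF p])
        also have "\<dots> \<le> seminorm_R R p (F f0 g0 - x) + (\<delta> * 1 + (\<delta> * ?q g0 + ?q f0 * \<delta>))"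
          using f g \<delta> q0
          by (intro add_left_mono add_mono order.trans[OF bound] mult_mono) simp_all
        also have "\<dots> = seminorm_R R p (F f0 g0 - x) + \<delta> * A"
          by (simp add: A_def algebra_simps)
        also have "\<dots> < \<epsilon>" using \<delta>A by (simp add: \<eta>_def)
        finally show "fg' \<in> ?P" by (simp add: fg' U F_def seval_in_sym_QP)
      qed
      moreover have "openin ?T ?B"
        using C(1) \<delta>(1) by (simp add: openin_prod_Times_iff openin_sym_topology_ball)
      moreover have "fg \<in> ?B" using \<delta>(1) by (simp add: fg seminorm_R_0)
      ultimately show "\<exists>T. openin ?T T \<and> fg \<in> T \<and> T \<subseteq> ?P" by blast
    qed
  next
    show "(\<lambda>(f, g). F f g) ` topspace ?T \<subseteq> \<Union> {{y \<in> sym_QP. p (y - x) < \<epsilon>} | p x \<epsilon>.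
      p \<in> R_seminorms R \<and> x \<in> sym_QP \<and> (0::real) < \<epsilon>}"
      unfolding Union_seminorm_balls by (auto simp: F_def seval_in_sym_QP)
  qed
  \<comment> \<open>The quotient carries the pullback topology along \<open>weyl_repr\<close>, so
    continuity only has to be checked after composing with it.\<close>
  moreover have "weyl_repr \<circ> (\<lambda>(f, g). weyl_proj h (gutt_star z f g)) = (\<lambda>(f, g). F f g)"
    by (auto simp: F_def weyl_repr_proj)
  ultimately show ?thesis
    unfolding weyl_topology_def
    by (intro continuous_map_pullback') (auto simp: weyl_proj_def quotientI)
qed

end
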